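(* Let $C(z),D(z)\in\mathbb{Z}[z]$ with $C(0)=D(0)=1$, and let $f(z)\in\mathbb{Z}[[z]]$ be the power series $$f(z)=\prod_{n\ge0}\frac{C(z^{3^n})}{D(z^{3^n})}.$$ Let $b\ge2$ be an integer such that $C(1/b^{3^m})D(1/b^{3^m})\neq0$ for all integers $m\ge0$. If the reduction of $f(z)$ modulo $3$ is not a rational function, then $f(1/b)$ is transcendental and its irrationality exponent is equal to $2$.
   Context: The reduction of $f$ modulo $3$ is the series in $\mathbb{F}_3[[z]]$ obtained by reducing each coefficient modulo 3; it is a rational function if it equals $P/Q$ for some $P,Q\in\mathbb{F}_3[z]$ with $Q\neq0$. The irrationality exponent $\mu(\xi)$ of an irrational real number $\xi$ is the supremum of the real numbers $\mu$ such that $|\xi-p/q|<q^{-\mu}$ has infinitely many solutions in rational numbers $p/q$. *)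

theory Defs
  imports "HOL-Analysis.Analysis" "HOL-Computational_Algebra.Computational_Algebra"
    "HOL-Library.Numeral_Type" "HOL-Library.Extended_Real"
begin

definition sub3pow :: "int poly \<Rightarrow> nat \<Rightarrow> int fps" where
  "sub3pow C n = fps_of_poly (pcompose C (monom 1 (3 ^ n)))"

text \<open>The formal power series f(z) = prod_{n>=0} C(z^(3^n)) / D(z^(3^n)) in Z[[z]].
  Since C(0) = D(0) = 1, the n-th factor is 1 + O(z^(3^n)), so the k-th coefficient of the
  infinite product equals the k-th coefficient of the finite product over n <= k.
  Division by D(z^(3^n)) is multiplication by its inverse in Z[[z]] (constant term 1).\<close>
definition mahler_fps :: "int poly \<Rightarrow> int poly \<Rightarrow> int fps" where
  "mahler_fps C D = Abs_fps (\<lambda>k.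
     ((\<Prod>n\<le>k. sub3pow C n * fps_right_inverse (sub3pow D n) 1)) $ k)"

definition reduce_mod3 :: "int fps \<Rightarrow> 3 fps" where
  "reduce_mod3 f = Abs_fps (\<lambda>k. of_int (f $ k))"

definition rational_fps :: "'a::comm_ring_1 fps \<Rightarrow> bool" where
  "rational_fps g \<longleftrightarrow> (\<exists>P Q :: 'a poly. Q \<noteq> 0 \<and> fps_of_poly Q * g = fps_of_poly P)"

definition mahler_value :: "int poly \<Rightarrow> int poly \<Rightarrow> int \<Rightarrow> real" where
  "mahler_value C D b = (\<Prod>n. poly (map_poly real_of_int C) (1 / real_of_int b ^ (3 ^ n))
                             / poly (map_poly real_of_int D) (1 / real_of_int b ^ (3 ^ n)))"

definition irrationality_exponent :: "real \<Rightarrow> ereal" where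
  "irrationality_exponent \<xi> = Sup (ereal ` {\<mu>::real. infinite {r::rat.
      \<bar>\<xi> - real_of_rat r\<bar> < real_of_int (snd (quotient_of r)) powr (- \<mu>)}})"

end

theory Submission
  imports Defs "Jordan_Normal_Form.Determinant" "HOL-Analysis.Kronecker_Approximation_Theorem"
begin

text \<open>
  The series satisfies \<open>D(z) f(z) = C(z) f(z\<^sup>3)\<close>, and \<open>f(z\<^sup>3)\<close> is congruent to \<open>f(z)\<^sup>3\<close> modulo 3, so
  \<open>C f\<^sup>2 = D\<close> modulo 3. An irrational quadratic series is badly approximable: Pade approximants
  \<open>P/Q\<close> of degree at most \<open>k\<close>, taken primitive modulo 3, satisfy
  \<open>2 k + 1 \<le> ord (Q f - P) \<le> 2 k + d\<close> with \<open>d = max (deg C) (deg D)\<close>. Evaluating at \<open>b ^ - (3 ^ m)\<close> and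
  carrying the values to \<open>1/b\<close> by the functional equation gives integer linear forms in
  \<open>1, f(1/b)\<close> that are so dense and so close to their expected size that the irrationality exponent is 2.

  Transcendence is Mahler's method. Over the complex rational functions, a minimal algebraic relation for
  \<open>f\<close> would make a power of \<open>f\<close> rational, and then \<open>f\<close> itself, by comparing multiplicities of
  zeros under cubing. So a Hermite-Pade form in \<open>1, f, \<dots>, f ^ L\<close> is nonzero and of large order,
  and its values at \<open>b ^ - (3 ^ m)\<close> contradict Liouville's inequality if \<open>f(1/b)\<close> is algebraic.
\<close>

subsection \<open>Congruences modulo 3 for integer power series\<close>



text \<open>Modulo 3 the series is algebraic, so the congruence settles how well \<open>f\<close> is
  approximated by rational functions but can never give transcendence. That has to come from the
  functional equation in characteristic 0, with the Pade remainders supplying irrationality over the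
  complex numbers.

  For the exponent, two features of the forms are decisive. The defect \<open>d\<close> does not
  depend on \<open>k\<close>. And the upper bound on the order of \<open>Q f - P\<close> becomes a
  lower bound for the form, which settles the case that an approximation \<open>u/q\<close> makes
  the integer \<open>q * g0 + g1 * u\<close> vanish. One fixed \<open>k\<close> would give forms of
  size about \<open>Y m ^ (k + d)\<close> only, and since \<open>Y (Suc m) = Y m ^ 3\<close> the
  gaps between these sizes are too wide. Letting \<open>k\<close> run through a finite range for
  each \<open>m\<close> puts a form within a factor \<open>Y m ^ O(d)\<close> of every
  \<open>q\<close> between \<open>Y m ^ s\<close> and \<open>Y m ^ (3 * s)\<close>; once
  \<open>s\<close> is large compared with \<open>d / (\<mu> - 2)\<close>, this loss is smaller than
  the gain \<open>q powr (\<mu> - 2)\<close>.\<close>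

lemma numeral_dvd_fps_iff: "(numeral k :: int fps) dvd F \<longleftrightarrow> (\<forall>n. numeral k dvd F $ n)"
proof
  assume "numeral k dvd F"
  then obtain G where "F = numeral k * G" by blast
  then show "\<forall>n. numeral k dvd F $ n"
    by (simp add: numeral_fps_const)
next
  assume *: "\<forall>n. numeral k dvd F $ n"
  have "F = numeral k * Abs_fps (\<lambda>n. F $ n div numeral k)"
    using * by (intro fps_ext) (simp add: numeral_fps_const)
  then show "numeral k dvd F" by (rule dvdI)
qed

text \<open>Gauss's argument: at the sum of the two least indices whose coefficients are prime to 3,
  exactly one term of the convolution is prime to 3.\<close>

lemma three_dvd_fps_mult:
  fixes F G :: "int fps"
  assumes "3 dvd F * G"
  shows "3 dvd F \<or> 3 dvd G"
proof (rule ccontr)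
  assume "\<not> ?thesis"
  then have F: "\<exists>i. \<not> 3 dvd F $ i" and G: "\<exists>i. \<not> 3 dvd G $ i"
    by (auto simp: numeral_dvd_fps_iff)
  define i where "i = (LEAST i. \<not> 3 dvd F $ i)"
  define j where "j = (LEAST j. \<not> 3 dvd G $ j)"
  have i: "\<not> 3 dvd F $ i" "\<And>k. k < i \<Longrightarrow> 3 dvd F $ k"
    unfolding i_def using LeastI_ex[OF F] not_less_Least by blast+
  have j: "\<not> 3 dvd G $ j" "\<And>k. k < j \<Longrightarrow> 3 dvd G $ k"
    unfolding j_def using LeastI_ex[OF G] not_less_Least by blast+
  have "(F * G) $ (i + j) = (\<Sum>k=0..i+j. F $ k * G $ (i + j - k))"
    by (simp add: fps_mult_nth)
  also have "\<dots> = F $ i * G $ j + (\<Sum>k\<in>{0..i+j} - {i}. F $ k * G $ (i + j - k))"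
    by (subst sum.remove[of _ i]) auto
  finally have eq: "(F * G) $ (i + j) = \<dots>" .
  have "3 dvd (\<Sum>k\<in>{0..i+j} - {i}. F $ k * G $ (i + j - k))"
  proof (rule dvd_sum)
    fix k assume k: "k \<in> {0..i+j} - {i}"
    show "3 dvd F $ k * G $ (i + j - k)"
    proof (cases "k < i")
      case True then show ?thesis using i(2) by simp
    next
      case False
      then have "i + j - k < j" using k by auto
      then show ?thesis using j(2) by simp
    qed
  qed
  moreover have "3 dvd (F * G) $ (i + j)"
    using assms by (simp add: numeral_dvd_fps_iff)
  ultimately have "3 dvd F $ i * G $ j"
    unfolding eq by (simp add: dvd_add_left_iff)
  moreover have "prime (3::int)" by simp
  ultimately show False using i(1) j(1) prime_dvd_multD by blast
qed

abbreviation subst_cube :: "'a::comm_ring_1 fps \<Rightarrow> 'a fps" where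
  "subst_cube F \<equiv> F oo fps_X ^ 3"

lemma fps_nth_decompose: "F = fps_const (F $ 0) + fps_X * fps_shift 1 F" for F :: "'a::comm_ring_1 fps"
  by (intro fps_ext) (auto simp: fps_X_mult_nth)

lemma subst_cube_mult: "subst_cube (F * G) = subst_cube F * subst_cube G" for F G :: "'a::idom fps"
  by (rule fps_compose_mult_distrib) simp

lemma subst_cube_shift:
  fixes F :: "'a::idom fps"
  shows "subst_cube F = fps_const (F $ 0) + fps_X ^ 3 * subst_cube (fps_shift 1 F)"
  by (subst fps_nth_decompose[of F]) (simp add: fps_compose_add_distrib subst_cube_mult)

lemma three_dvd_cube_minus_self: "3 dvd a ^ 3 - (a::int)"
proof -
  have "a mod 3 = 0 \<or> a mod 3 = 1 \<or> a mod 3 = 2" by presburger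
  then have "a ^ 3 mod 3 = a mod 3"
    by (auto simp: power_mod[symmetric, of a])
  then show ?thesis by (simp add: mod_eq_dvd_iff)
qed

text \<open>Split off the constant term, \<open>F = a + z G\<close>. The mixed terms of the cube
  carry a factor 3, the constants agree by Fermat, and the rest is \<open>z ^ 3\<close> times the
  same difference for \<open>G\<close>, so coefficient \<open>n\<close> reduces to coefficient
  \<open>n - 3\<close>.\<close>

lemma three_dvd_cube_minus_subst_cube: "3 dvd F ^ 3 - subst_cube F" for F :: "int fps"
proof -
  have "3 dvd (F ^ 3 - subst_cube F) $ n" for n
  proof (induction n arbitrary: F rule: less_induct)
    case (less n)
    define a G where "a = F $ 0" and "G = fps_shift 1 F"
    have F: "F = fps_const a + fps_X * G"
      unfolding a_def G_def by (rule fps_nth_decompose)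
    have 1: "F ^ 3 = fps_const (a ^ 3) + fps_X ^ 3 * G ^ 3
        + 3 * (fps_const a ^ 2 * (fps_X * G) + fps_const a * (fps_X * G) ^ 2)"
      unfolding F by (simp add: power3_eq_cube power2_eq_square algebra_simps flip: fps_const_power)
    have 2: "subst_cube F = fps_const a + fps_X ^ 3 * subst_cube G"
      unfolding a_def G_def by (rule subst_cube_shift)
    have eq: "F ^ 3 - subst_cube F = fps_const (a ^ 3 - a) + fps_X ^ 3 * (G ^ 3 - subst_cube G)
        + 3 * (fps_const a ^ 2 * (fps_X * G) + fps_const a * (fps_X * G) ^ 2)"
      unfolding 1 2 by (simp add: algebra_simps flip: fps_const_sub)
    have "3 dvd (fps_X ^ 3 * (G ^ 3 - subst_cube G)) $ n"
      by (cases "n < 3") (use less[of "n - 3" G] in \<open>auto simp: fps_X_power_mult_nth\<close>)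
    moreover have "3 dvd fps_const (a ^ 3 - a) $ n"
      using three_dvd_cube_minus_self[of a] by (cases n) (simp_all del: fps_const_sub)
    moreover have "3 dvd (3 * H) $ n" for H :: "int fps"
      by (metis dvd_triv_left numeral_dvd_fps_iff)
    ultimately show ?case
      unfolding eq by (simp only: fps_add_nth dvd_add)
  qed
  then show ?thesis by (simp add: numeral_dvd_fps_iff)
qed

subsection \<open>The functional equation\<close>

definition mahler_factor :: "int poly \<Rightarrow> int poly \<Rightarrow> nat \<Rightarrow> int fps" where
  "mahler_factor C D n = sub3pow C n * fps_right_inverse (sub3pow D n) 1"

lemma fps_X_power_compose_cube: "subst_cube (fps_X ^ n) = (fps_X ^ (3 * n) :: 'a::idom fps)"
  by (subst fps_compose_power[symmetric]) (simp_all add: power_mult)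

lemma subst_cube_pow_iter:
  "subst_cube (F oo fps_X ^ (3 ^ n)) = F oo fps_X ^ (3 ^ Suc n)" for F :: "'a::idom fps"
  by (subst fps_compose_assoc[symmetric]) (simp_all add: fps_X_power_compose_cube)

lemma sub3pow_altdef: "sub3pow C n = fps_of_poly C oo fps_X ^ (3 ^ n)"
  by (simp add: sub3pow_def fps_of_poly_pcompose coeff_monom fps_of_poly_monom)

lemma sub3pow_0: "sub3pow C 0 = fps_of_poly C"
  by (simp add: sub3pow_altdef)

lemma sub3pow_Suc: "sub3pow C (Suc n) = subst_cube (sub3pow C n)"
  unfolding sub3pow_altdef by (rule subst_cube_pow_iter[symmetric])

lemma sub3pow_nth_0: "sub3pow C n $ 0 = poly C 0"
  by (simp add: sub3pow_altdef poly_0_coeff_0)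

lemma fps_compose_power_nth_small:
  fixes F :: "'a::idom fps"
  assumes "j < N"
  shows "(F oo fps_X ^ N) $ j = (if j = 0 then F $ 0 else 0)"
proof -
  have "(F oo fps_X ^ N) $ j = (\<Sum>i=0..j. F $ i * (fps_X ^ (N * i)) $ j)"
    by (simp add: fps_compose_nth power_mult)
  also have "\<dots> = (\<Sum>i=0..j. if i = 0 then (if j = 0 then F $ 0 else 0) else 0)"
  proof (intro sum.cong refl)
    fix i assume "i \<in> {0..j}"
    have "j \<noteq> N * i" if "i > 0" using that assms by (cases i) auto
    then show "F $ i * (fps_X ^ (N * i)) $ j = (if i = 0 then (if j = 0 then F $ 0 else 0) else 0)"
      by (auto simp: fps_X_power_nth)
  qed
  also have "\<dots> = (if j = 0 then F $ 0 else 0)" by simp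
  finally show ?thesis .
qed

lemma fps_mult_nth_eq_1_upto:
  fixes F G :: "'a::comm_ring_1 fps"
  assumes "\<And>i. i \<le> k \<Longrightarrow> G $ i = (if i = 0 then 1 else 0)"
  shows "(F * G) $ k = F $ k"
proof -
  have "(F * G) $ k = (\<Sum>i=0..k. F $ i * (if k = i then 1 else 0))"
    unfolding fps_mult_nth using assms by (intro sum.cong) auto
  then show ?thesis by (simp add: if_distrib sum.delta cong: if_cong)
qed

lemma fps_mult_nth_cong:
  fixes F G H :: "'a::comm_ring_1 fps"
  assumes "\<And>j. j \<le> k \<Longrightarrow> G $ j = H $ j"
  shows "(F * G) $ k = (F * H) $ k"
  using assms by (auto simp: fps_mult_nth intro!: sum.cong)

context
  fixes C D :: "int poly"
  assumes C0: "poly C 0 = 1" and D0: "poly D 0 = 1"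
begin

lemma sub3pow_mult_mahler_factor: "sub3pow D n * mahler_factor C D n = sub3pow C n"
  using fps_right_inverse[of "sub3pow D n" 1] D0
  by (simp add: mahler_factor_def sub3pow_nth_0 mult.left_commute)

lemma sub3pow_neq_0: "sub3pow D n \<noteq> 0"
  by (metis D0 fps_nonzeroI sub3pow_nth_0 zero_neq_one)

lemma mahler_factor_Suc: "mahler_factor C D (Suc n) = subst_cube (mahler_factor C D n)"
proof -
  have "sub3pow D (Suc n) * subst_cube (mahler_factor C D n) = sub3pow D (Suc n) * mahler_factor C D (Suc n)"
    by (metis sub3pow_Suc sub3pow_mult_mahler_factor subst_cube_mult)
  then show ?thesis using sub3pow_neq_0 by simp
qed

lemma mahler_factor_altdef: "mahler_factor C D n = mahler_factor C D 0 oo fps_X ^ (3 ^ n)"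
  by (induction n) (simp_all only: mahler_factor_Suc subst_cube_pow_iter power_0 power_one_right fps_compose_fps_X)

lemma mahler_factor_nth_small:
  assumes "j < 3 ^ n"
  shows "mahler_factor C D n $ j = (if j = 0 then 1 else 0)"
proof -
  have "mahler_factor C D 0 $ 0 = 1"
    using C0 by (simp add: mahler_factor_def sub3pow_nth_0)
  then show ?thesis
    using assms by (subst mahler_factor_altdef) (simp add: fps_compose_power_nth_small)
qed

text \<open>The definition reads coefficient \<open>k\<close> off the product over
  \<open>n \<le> k\<close>. Longer products give the same value, because each further factor is 1 up
  to an order that exceeds \<open>k\<close>.\<close>

lemma prod_mahler_factor_nth:
  assumes "k \<le> n"
  shows "(\<Prod>i\<le>n. mahler_factor C D i) $ k = mahler_fps C D $ k"
  using assms
proof (induction n rule: dec_induct)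
  case base
  then show ?case by (simp add: mahler_fps_def mahler_factor_def)
next
  case (step n)
  have "k \<le> n" by fact
  also have "n < 2 ^ n" by (rule less_exp)
  also have "\<dots> \<le> (3::nat) ^ n" by (rule power_mono) auto
  also have "\<dots> \<le> 3 ^ Suc n" by simp
  finally have "k < 3 ^ Suc n" .
  then have "(\<Prod>i\<le>Suc n. mahler_factor C D i) $ k = (\<Prod>i\<le>n. mahler_factor C D i) $ k"
    unfolding prod.atMost_Suc by (intro fps_mult_nth_eq_1_upto mahler_factor_nth_small) simp
  then show ?case using step by simp
qed

lemma mahler_fps_nth_0: "mahler_fps C D $ 0 = 1"
  using prod_mahler_factor_nth[of 0 0] mahler_factor_nth_small[of 0 0] by simp

lemma mahler_functional_equation:
  "fps_of_poly D * mahler_fps C D = fps_of_poly C * subst_cube (mahler_fps C D)"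
proof (rule fps_ext)
  fix k
  define P where "P = (\<Prod>i\<le>k. mahler_factor C D i)"
  have sub: "subst_cube P = (\<Prod>i\<le>k. mahler_factor C D (Suc i))"
    unfolding P_def by (subst fps_compose_prod_distrib) (simp_all add: mahler_factor_Suc)
  \<comment> \<open>Substituting \<open>z ^ 3\<close> shifts the factors by one, so the finite
    product with one more factor satisfies the functional equation exactly; only coefficients up to
    \<open>k\<close> are then compared.\<close>
  have "(\<Prod>i\<le>Suc k. mahler_factor C D i) = mahler_factor C D 0 * subst_cube P"
    unfolding sub by (rule prod.atMost_Suc_shift)
  then have *: "fps_of_poly D * (\<Prod>i\<le>Suc k. mahler_factor C D i) = fps_of_poly C * subst_cube P"
    using sub3pow_mult_mahler_factor[of 0] by (simp add: sub3pow_0 mult.assoc[symmetric])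
  have "(fps_of_poly D * mahler_fps C D) $ k = (fps_of_poly D * (\<Prod>i\<le>Suc k. mahler_factor C D i)) $ k"
    by (rule fps_mult_nth_cong) (simp add: prod_mahler_factor_nth del: prod.atMost_Suc)
  also have "\<dots> = (fps_of_poly C * subst_cube (mahler_fps C D)) $ k"
    unfolding * by (rule fps_mult_nth_cong)
      (auto simp: fps_compose_nth P_def prod_mahler_factor_nth intro!: sum.cong)
  finally show "(fps_of_poly D * mahler_fps C D) $ k = (fps_of_poly C * subst_cube (mahler_fps C D)) $ k" .
qed

text \<open>With \<open>f(z\<^sup>3)\<close> replaced by \<open>f\<^sup>3\<close>, the functional
  equation says that 3 divides \<open>f (D - C f\<^sup>2)\<close>. The factor \<open>f\<close> has
  constant term 1 and cancels, 3 being prime in the power series ring.\<close>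

lemma three_dvd_quadratic_equation: "3 dvd fps_of_poly D - fps_of_poly C * mahler_fps C D ^ 2"
proof -
  let ?f = "mahler_fps C D"
  have "?f * (fps_of_poly D - fps_of_poly C * ?f ^ 2) = - fps_of_poly C * (?f ^ 3 - subst_cube ?f)"
    using mahler_functional_equation by (simp add: algebra_simps power2_eq_square power3_eq_cube)
  then have "3 dvd ?f * (fps_of_poly D - fps_of_poly C * ?f ^ 2)"
    by (metis dvd_mult three_dvd_cube_minus_subst_cube)
  moreover have "\<not> 3 dvd ?f $ 0"
    by (simp add: mahler_fps_nth_0)
  then have "\<not> 3 dvd ?f"
    unfolding numeral_dvd_fps_iff by blast
  ultimately show ?thesis using three_dvd_fps_mult by blast
qed

end


subsection \<open>Pade approximants\<close>

lemma three_dvd_fps_of_poly_iff: "3 dvd fps_of_poly P \<longleftrightarrow> (\<forall>j. 3 dvd coeff P j)" for P :: "int poly"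
  by (simp add: numeral_dvd_fps_iff)

lemma of_int_eq_0_iff_3: "(of_int x :: 3) = 0 \<longleftrightarrow> 3 dvd x"
proof -
  have "(of_int x :: 3) = of_int (3 * (x div 3) + x mod 3)" by simp
  also have "\<dots> = 3 * of_int (x div 3) + of_int (x mod 3)" by (simp only: of_int_add of_int_mult of_int_numeral)
  also have "(3 :: 3) = 0" by simp
  finally have "(of_int x :: 3) = of_int (x mod 3)" by simp
  moreover have "x mod 3 = 0 \<or> x mod 3 = 1 \<or> x mod 3 = 2" by presburger
  moreover have "(1 :: 3) \<noteq> 0" by simp
  moreover have "(2 :: 3) \<noteq> 0" by simp
  ultimately show ?thesis by (auto simp: dvd_eq_mod_eq_0)
qed

text \<open>This links divisibility by 3 among integer series to rationality over the field with
  three elements, so that all other arguments modulo 3 can stay with integer series.\<close>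

lemma reduce_mod3_rational:
  fixes P Q :: "int poly"
  assumes "3 dvd fps_of_poly Q * f - fps_of_poly P" and "\<not> 3 dvd fps_of_poly Q"
  shows "rational_fps (reduce_mod3 f)"
proof -
  define P' Q' where "P' = (map_poly of_int P :: 3 poly)" and "Q' = (map_poly of_int Q :: 3 poly)"
  have coeffs: "coeff P' n = of_int (coeff P n)" "coeff Q' n = of_int (coeff Q n)" for n
    by (simp_all add: P'_def Q'_def coeff_map_poly)
  have "Q' \<noteq> 0"
    using assms(2) coeffs(2) of_int_eq_0_iff_3 by (metis coeff_0 three_dvd_fps_of_poly_iff)
  moreover have "fps_of_poly Q' * reduce_mod3 f = fps_of_poly P'"
  proof (rule fps_ext)
    fix n
    have "3 dvd (fps_of_poly Q * f) $ n - coeff P n"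
      using assms(1) by (simp add: numeral_dvd_fps_iff)
    then have "(of_int ((fps_of_poly Q * f) $ n) :: 3) = of_int (coeff P n)"
      using of_int_eq_0_iff_3[of "(fps_of_poly Q * f) $ n - coeff P n"] by simp
    then show "(fps_of_poly Q' * reduce_mod3 f) $ n = fps_of_poly P' $ n"
      by (simp add: fps_mult_nth coeffs reduce_mod3_def)
  qed
  ultimately show ?thesis unfolding rational_fps_def by blast
qed

text \<open>A zero row turns the \<open>n\<close> equations in \<open>n + 1\<close> unknowns into a
  square system of determinant 0, which has a nonzero kernel vector already over the
  integers.\<close>

lemma homogeneous_system_solution:
  fixes a :: "nat \<Rightarrow> nat \<Rightarrow> int"
  shows "\<exists>x. (\<exists>j\<le>n. x j \<noteq> 0) \<and> (\<forall>i<n. (\<Sum>j\<le>n. a i j * x j) = 0)"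
proof -
  define A where "A = mat\<^sub>r (Suc n) (Suc n) (\<lambda>i. if i = n then 0\<^sub>v (Suc n) else vec (Suc n) (a i))"
  have A: "A \<in> carrier_mat (Suc n) (Suc n)" by (simp add: A_def)
  have "det A = 0"
    unfolding A_def by (rule det_row_0) auto
  then obtain v where v: "v \<in> carrier_vec (Suc n)" "v \<noteq> 0\<^sub>v (Suc n)" "A *\<^sub>v v = 0\<^sub>v (Suc n)"
    using det_0_iff_vec_prod_zero[OF A] by blast
  have "\<exists>j\<le>n. vec_index v j \<noteq> 0"
  proof (rule ccontr)
    assume "\<not> ?thesis"
    then have "v = 0\<^sub>v (Suc n)" using v(1) by (intro eq_vecI) auto
    then show False using v(2) by simp
  qed
  moreover have "(\<Sum>j\<le>n. a i j * vec_index v j) = 0" if "i < n" for i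
  proof -
    have "vec_index (A *\<^sub>v v) i = (\<Sum>j = 0..<Suc n. a i j * vec_index v j)"
    proof -
      have "vec_index (A *\<^sub>v v) i = row A i \<bullet> v" using A that by simp
      also have "row A i = vec (Suc n) (a i)"
        using that unfolding A_def by (subst row_mat_of_row_fun) auto
      finally show ?thesis using v(1) by (simp add: scalar_prod_def del: sum.op_ivl_Suc)
    qed
    then show ?thesis using v(3) that by (simp add: lessThan_Suc_atMost atLeast0LessThan del: sum.op_ivl_Suc)
  qed
  ultimately show ?thesis by (intro exI[of _ "vec_index v"]) blast
qed

text \<open>Descent: a solution with all entries divisible by \<open>p\<close> is divided by
  \<open>p\<close>, which strictly decreases the sum of the absolute values.\<close>

lemma homogeneous_system_primitive_solution:
  fixes a :: "nat \<Rightarrow> nat \<Rightarrow> int" and p :: int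
  assumes "p > 1"
  shows "\<exists>x. (\<exists>j\<le>n. \<not> p dvd x j) \<and> (\<forall>i<n. (\<Sum>j\<le>n. a i j * x j) = 0)"
proof -
  have "(\<exists>j\<le>n. x j \<noteq> 0) \<Longrightarrow> (\<forall>i<n. (\<Sum>j\<le>n. a i j * x j) = 0) \<Longrightarrow> ?thesis" for x
  proof (induction "nat (\<Sum>j\<le>n. \<bar>x j\<bar>)" arbitrary: x rule: less_induct)
    case less
    show ?case
    proof (cases "\<exists>j\<le>n. \<not> p dvd x j")
      case True then show ?thesis using less.prems by blast
    next
      case False
      define y where "y j = x j div p" for j
      have xy: "x j = p * y j" if "j \<le> n" for j using False that by (simp add: y_def)
      have "0 < (\<Sum>j\<le>n. \<bar>x j\<bar>)"
      proof -
        obtain j where "j \<le> n" "x j \<noteq> 0" using less.prems(1) by blast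
        then show ?thesis by (intro sum_pos2[of _ j]) auto
      qed
      moreover have "(\<Sum>j\<le>n. \<bar>x j\<bar>) = p * (\<Sum>j\<le>n. \<bar>y j\<bar>)"
        unfolding sum_distrib_left using assms by (intro sum.cong) (auto simp: xy abs_mult)
      ultimately have "(\<Sum>j\<le>n. \<bar>y j\<bar>) < (\<Sum>j\<le>n. \<bar>x j\<bar>)"
        using assms by (simp add: zero_less_mult_iff)
      then have small: "nat (\<Sum>j\<le>n. \<bar>y j\<bar>) < nat (\<Sum>j\<le>n. \<bar>x j\<bar>)"
        using \<open>0 < (\<Sum>j\<le>n. \<bar>x j\<bar>)\<close> by simp
      have "\<exists>j\<le>n. y j \<noteq> 0" using less.prems(1) xy by force
      moreover have "(\<Sum>j\<le>n. a i j * y j) = 0" if "i < n" for i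
      proof -
        have "p * (\<Sum>j\<le>n. a i j * y j) = (\<Sum>j\<le>n. a i j * x j)"
          unfolding sum_distrib_left by (intro sum.cong) (auto simp: xy)
        then show ?thesis using less.prems(2) that assms by auto
      qed
      ultimately show ?thesis using less.hyps[OF small] by blast
    qed
  qed
  then show ?thesis using homogeneous_system_solution[of n a] by blast
qed

text \<open>There are \<open>(L + 1) * (M + 1)\<close> unknown coefficients and one equation fewer.
  The modulus \<open>p\<close> expresses nontriviality: for \<open>p = 3\<close> it gives the
  primitivity that the congruence argument uses, for other \<open>p\<close> it certifies a nonzero
  family.\<close>

lemma Hermite_Pade_approximants:
  fixes G :: "nat \<Rightarrow> int fps" and p :: int
  assumes "p > 1"
  obtains P where "\<And>i. i \<le> L \<Longrightarrow> degree (P i) \<le> M" and "\<exists>i\<le>L. \<exists>j. \<not> p dvd coeff (P i) j"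
    and "\<And>n. n < (L + 1) * (M + 1) - 1 \<Longrightarrow> (\<Sum>i\<le>L. fps_of_poly (P i) * G i) $ n = 0"
proof -
  define N where "N = (L + 1) * (M + 1) - 1"
  have SucN: "Suc N = (L + 1) * (M + 1)" by (simp add: N_def)
  \<comment> \<open>Unknown number \<open>k\<close> stands for the coefficient of
    \<open>z ^ (k mod (M + 1))\<close> in the polynomial with index \<open>k div (M + 1)\<close>;
    \<open>a n k\<close> is its contribution to coefficient \<open>n\<close> of the form.\<close>
  define a where "a n k = (if k mod (M + 1) \<le> n then G (k div (M + 1)) $ (n - k mod (M + 1)) else 0)" for n k
  obtain x where x: "\<exists>k\<le>N. \<not> p dvd x k" "\<And>n. n < N \<Longrightarrow> (\<Sum>k\<le>N. a n k * x k) = 0"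
    using homogeneous_system_primitive_solution[OF assms, of N a] by blast
  define P where "P i = (\<Sum>j\<le>M. monom (x (i * (M + 1) + j)) j)" for i
  have coeff_P: "coeff (P i) j = (if j \<le> M then x (i * (M + 1) + j) else 0)" for i j
    by (simp add: P_def coeff_sum coeff_monom)
  show thesis
  proof (rule that[of P])
    show "degree (P i) \<le> M" for i
      by (rule degree_le) (simp add: coeff_P)
    obtain k where k: "k \<le> N" "\<not> p dvd x k" using x(1) by blast
    have "k div (M + 1) < L + 1"
      using k(1) SucN by (simp add: less_mult_imp_div_less less_Suc_eq_le[symmetric] del: mult_Suc)
    moreover have "coeff (P (k div (M + 1))) (k mod (M + 1)) = x k"
      using mod_less_divisor[of "M + 1" k] div_mult_mod_eq[of k "M + 1"]
      by (simp add: coeff_P del: mult_Suc_right)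
    ultimately show "\<exists>i\<le>L. \<exists>j. \<not> p dvd coeff (P i) j"
      using k(2) by (intro exI[of _ "k div (M + 1)"] conjI exI[of _ "k mod (M + 1)"]) auto
    fix n assume "n < (L + 1) * (M + 1) - 1"
    then have n: "n < N" by (simp add: N_def)
    have "(fps_of_poly (P i) * G i) $ n = (\<Sum>j\<le>M. if j \<le> n then x (i * (M + 1) + j) * G i $ (n - j) else 0)" for i
    proof -
      have "(fps_of_poly (P i) * G i) $ n = (\<Sum>j=0..n. if j \<le> M then x (i * (M + 1) + j) * G i $ (n - j) else 0)"
        unfolding fps_mult_nth by (intro sum.cong) (auto simp: coeff_P)
      also have "\<dots> = (\<Sum>j\<in>{0..n} \<inter> {..M}. x (i * (M + 1) + j) * G i $ (n - j))"
        by (subst sum.inter_restrict) (simp_all only: finite_atLeastAtMost atMost_iff)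
      also have "\<dots> = (\<Sum>j\<in>{..M} \<inter> {..n}. x (i * (M + 1) + j) * G i $ (n - j))"
        by (rule sum.cong) auto
      also have "\<dots> = (\<Sum>j\<le>M. if j \<le> n then x (i * (M + 1) + j) * G i $ (n - j) else 0)"
        by (subst sum.inter_restrict) (simp_all only: finite_atMost atMost_iff)
      finally show ?thesis .
    qed
    then have "(\<Sum>i\<le>L. fps_of_poly (P i) * G i) $ n =
        (\<Sum>i\<le>L. \<Sum>j\<le>M. if j \<le> n then x (i * (M + 1) + j) * G i $ (n - j) else 0)"
      by (simp add: fps_sum_nth)
    also have "\<dots> = (\<Sum>i<Suc L. \<Sum>j<Suc M. a n (j + i * Suc M) * x (j + i * Suc M))"
    proof (intro sum.cong)
      fix i j assume "j \<in> {..<Suc M}"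
      then have "(j + i * Suc M) mod Suc M = j" "(j + i * Suc M) div Suc M = i"
        by (simp_all only: mod_mult_self1 div_mult_self1 mod_less div_less lessThan_iff)
      then show "(if j \<le> n then x (i * (M + 1) + j) * G i $ (n - j) else 0) =
          a n (j + i * Suc M) * x (j + i * Suc M)"
        by (simp add: a_def add.commute)
    qed (simp_all add: lessThan_Suc_atMost)
    also have "\<dots> = (\<Sum>k<Suc L * Suc M. a n k * x k)"
    proof -
      have "(\<Sum>k\<in>{i * Suc M..<i * Suc M + Suc M}. a n k * x k) =
          (\<Sum>j<Suc M. a n (j + i * Suc M) * x (j + i * Suc M))" for i
        using sum.shift_bounds_nat_ivl[of "\<lambda>k. a n k * x k" 0 "i * Suc M" "Suc M"]
        by (simp only: add_0 add.commute[of "Suc M"] atLeast0LessThan)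
      then show ?thesis by (simp only: sum.nat_group[symmetric])
    qed
    also have "\<dots> = (\<Sum>k\<le>N. a n k * x k)"
      using SucN by (simp add: lessThan_Suc_atMost[symmetric])
    also have "\<dots> = 0" using x(2) n by blast
    finally show "(\<Sum>i\<le>L. fps_of_poly (P i) * G i) $ n = 0" .
  qed
qed

context
  fixes C D :: "int poly"
  assumes C0: "poly C 0 = 1" and D0: "poly D 0 = 1"
    and irrational: "\<not> rational_fps (reduce_mod3 (mahler_fps C D))"
begin

text \<open>Modulo 3 the series is quadratic over the rational functions, hence badly approximable:
  \<open>C (Q f - P) (Q f + P)\<close> is congruent to the polynomial \<open>D Q\<^sup>2 - C P\<^sup>2\<close>.\<close>
lemma mahler_fps_badly_approximable_mod_3:
  assumes "degree C \<le> d" "degree D \<le> d" "degree P \<le> k" "degree Q \<le> k"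
    and prim: "\<not> 3 dvd fps_of_poly P \<or> \<not> 3 dvd fps_of_poly Q"
  shows "\<exists>j\<le>2*k+d. \<not> 3 dvd (fps_of_poly Q * mahler_fps C D - fps_of_poly P) $ j"
proof (rule ccontr)
  assume "\<not> ?thesis"
  then have small: "\<And>j. j \<le> 2*k+d \<Longrightarrow> 3 dvd (fps_of_poly Q * mahler_fps C D - fps_of_poly P) $ j"
    by blast
  let ?f = "mahler_fps C D"
  let ?P = "fps_of_poly P" and ?Q = "fps_of_poly Q" and ?C = "fps_of_poly C" and ?D = "fps_of_poly D"
  define R where "R = D * Q^2 - C * P^2"
  have "degree (D * Q^2) \<le> 2*k+d" "degree (C * P^2) \<le> 2*k+d"
    using assms(1-4) degree_mult_le[of D "Q^2"] degree_mult_le[of C "P^2"]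
      degree_power_le[of Q 2] degree_power_le[of P 2] by linarith+
  then have degR: "degree R \<le> 2*k+d" unfolding R_def by (rule degree_diff_le)
  have "?C * ((?Q * ?f - ?P) * (?Q * ?f + ?P)) = fps_of_poly R - ?Q^2 * (?D - ?C * ?f^2)"
    by (simp add: R_def fps_of_poly_diff fps_of_poly_mult fps_of_poly_power algebra_simps power2_eq_square)
  then have eq: "fps_of_poly R = (?Q * ?f - ?P) * (?C * (?Q * ?f + ?P)) + ?Q^2 * (?D - ?C * ?f^2)"
    by (simp add: algebra_simps)
  have 3: "3 dvd ?Q^2 * (?D - ?C * ?f^2)"
    using three_dvd_quadratic_equation[OF C0 D0] by (rule dvd_mult)
  have "3 dvd coeff R j" for j
  proof (cases "j \<le> 2*k+d")
    case True
    have "3 dvd ((?Q * ?f - ?P) * H) $ j" for H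
      unfolding fps_mult_nth using True small by (intro dvd_sum dvd_mult2) simp
    moreover have "3 dvd (?Q^2 * (?D - ?C * ?f^2)) $ j"
      using 3 numeral_dvd_fps_iff by blast
    ultimately have "3 dvd fps_of_poly R $ j" unfolding eq fps_add_nth by (rule dvd_add)
    then show ?thesis by simp
  next
    case False then show ?thesis using degR by (simp add: coeff_eq_0)
  qed
  then have R: "3 dvd fps_of_poly R" by (simp add: three_dvd_fps_of_poly_iff)
  have C: "\<not> 3 dvd ?C"
    using C0 by (auto simp: three_dvd_fps_of_poly_iff poly_0_coeff_0 intro!: exI[of _ 0])
  \<comment> \<open>If 3 divided \<open>Q\<close>, then \<open>R = D Q\<^sup>2 - C P\<^sup>2\<close>
    being 0 modulo 3 would force 3 to divide \<open>P\<close>, against primitivity.\<close>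
  have Q: "\<not> 3 dvd ?Q"
  proof
    assume Q3: "3 dvd ?Q"
    have "?C * ?P^2 = ?D * ?Q^2 - fps_of_poly R"
      unfolding R_def fps_of_poly_diff fps_of_poly_mult fps_of_poly_power by simp
    moreover have "3 dvd ?D * ?Q^2 - fps_of_poly R"
      using R Q3 by (simp add: power2_eq_square)
    ultimately have "3 dvd ?C * (?P * ?P)" by (simp only: power2_eq_square)
    then have "3 dvd ?P" using C three_dvd_fps_mult by blast
    then show False using prim Q3 by blast
  qed
  \<comment> \<open>Now \<open>f\<close> is congruent to \<open>P/Q\<close> or to
    \<open>- P/Q\<close>; either one makes the reduction rational.\<close>
  have "3 dvd ?C * ((?Q * ?f - ?P) * (?Q * ?f + ?P))"
    unfolding \<open>?C * ((?Q * ?f - ?P) * (?Q * ?f + ?P)) = _\<close> using R 3 by (rule dvd_diff)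
  then have "3 dvd ?Q * ?f - ?P \<or> 3 dvd ?Q * ?f + ?P"
    using C three_dvd_fps_mult by blast
  then have "3 dvd ?Q * ?f - ?P \<or> 3 dvd ?Q * ?f - fps_of_poly (-P)"
    by (simp add: fps_of_poly_uminus)
  then show False using reduce_mod3_rational Q irrational by blast
qed

text \<open>The lower bound on the order counts the \<open>2 * (k + 1) - 1\<close> equations. The
  upper bound comes from modulo 3: a coefficient not divisible by 3 is a nonzero integer, so bad
  approximability of the reduction passes to the integer series.\<close>

lemma Pade_approximants:
  assumes "degree C \<le> d" "degree D \<le> d"
  obtains P Q where "degree P \<le> k" "degree Q \<le> k"
    "fps_of_poly Q * mahler_fps C D - fps_of_poly P \<noteq> 0"
    "2 * k + 1 \<le> subdegree (fps_of_poly Q * mahler_fps C D - fps_of_poly P)"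
    "subdegree (fps_of_poly Q * mahler_fps C D - fps_of_poly P) \<le> 2 * k + d"
proof -
  obtain R where R: "\<And>i. i \<le> 1 \<Longrightarrow> degree (R i) \<le> k" "\<exists>i\<le>1. \<exists>j. \<not> 3 dvd coeff (R i) j"
    "\<And>n. n < (1 + 1) * (k + 1) - 1 \<Longrightarrow> (\<Sum>i\<le>1. fps_of_poly (R i) * mahler_fps C D ^ i) $ n = 0"
    using Hermite_Pade_approximants[of 3 1 k "\<lambda>i. mahler_fps C D ^ i"] by auto
  define P Q where "P = - R 0" and "Q = R 1"
  let ?E = "fps_of_poly Q * mahler_fps C D - fps_of_poly P"
  have E: "?E = (\<Sum>i\<le>1. fps_of_poly (R i) * mahler_fps C D ^ i)"
    by (simp add: P_def Q_def fps_of_poly_uminus)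
  have deg: "degree P \<le> k" "degree Q \<le> k" using R(1) by (auto simp: P_def Q_def)
  have "\<not> 3 dvd fps_of_poly P \<or> \<not> 3 dvd fps_of_poly Q"
    using R(2) by (auto simp: three_dvd_fps_of_poly_iff P_def Q_def le_Suc_eq)
  from mahler_fps_badly_approximable_mod_3[OF assms deg this]
  obtain j where j: "j \<le> 2*k+d" "\<not> 3 dvd ?E $ j" by blast
  then have nz: "?E $ j \<noteq> 0" by auto
  then have E0: "?E \<noteq> 0" by (metis fps_zero_nth)
  have "subdegree ?E \<le> 2*k+d" using subdegree_leI[OF nz] j(1) by simp
  moreover have "2*k+1 \<le> subdegree ?E"
    using E0 R(3) by (intro subdegree_geI) (auto simp: E)
  ultimately show thesis using that deg E0 by blast
qed

end


subsection \<open>Transcendence over the rational functions\<close>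

text \<open>The Laurent series \<open>F / G\<close> has a constant \<open>n\<close>-th power, hence
  derivative 0, and in characteristic 0 it is constant.\<close>

lemma fps_power_eq_const_mult_power:
  fixes F G :: "'a::field_char_0 fps"
  assumes "F ^ n = fps_const c * G ^ n" and "G \<noteq> 0" and "n > 0"
  shows "\<exists>k. F = fps_const k * G"
proof (cases "F = 0")
  case True
  then show ?thesis by (intro exI[of _ 0]) simp
next
  case False
  define R where "R = fps_to_fls F / fps_to_fls G"
  have G: "fps_to_fls G \<noteq> 0" using assms(2) by simp
  have R0: "R \<noteq> 0" using False assms(2) by (simp add: R_def)
  have "fps_to_fls F ^ n = fls_const c * fps_to_fls G ^ n"
    using arg_cong[OF assms(1), of fps_to_fls] by (simp add: fps_to_fls_power fls_times_fps_to_fls)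
  then have "R ^ n = fls_const c"
    using G by (simp add: R_def power_divide)
  then have "fls_deriv (R ^ n) = 0" by simp
  then have "of_nat n * R ^ (n - 1) * fls_deriv R = 0"
    by (simp add: fls_deriv_power)
  then have dR: "fls_deriv R = 0" using R0 assms(3) by simp
  have "R = fls_const (fls_nth R 0)"
  proof (rule fls_eqI)
    fix m
    have "of_int m * fls_nth R m = 0"
      using arg_cong[OF dR, of "\<lambda>f. fls_nth f (m - 1)"] by simp
    then show "fls_nth R m = fls_nth (fls_const (fls_nth R 0)) m" by auto
  qed
  moreover have "fps_to_fls F = R * fps_to_fls G" using G by (simp add: R_def)
  ultimately have "fps_to_fls F = fps_to_fls (fps_const (fls_nth R 0) * G)"
    by (simp add: fls_times_fps_to_fls)
  then show ?thesis unfolding fps_to_fls_eq_iff by blast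
qed

text \<open>Substituting \<open>z ^ 3\<close> triples orders, so every nonzero solution
  \<open>H\<close> of the equation has the order of \<open>G\<close>. Subtracting the multiple of
  \<open>G\<close> that cancels the coefficient at this order leaves a solution that can only be
  0.\<close>

lemma subst_cube_proportional:
  fixes F G :: "'a::field fps"
  assumes "F * subst_cube G = subst_cube F * G" and "G \<noteq> 0"
  shows "\<exists>c. F = fps_const c * G"
proof -
  have sub: "subdegree (subst_cube H) = 3 * subdegree H" for H :: "'a fps" by simp
  have subst0: "subst_cube H \<noteq> 0" if "H \<noteq> 0" for H :: "'a fps"
    using that by (simp add: fps_compose_eq_0_iff)
  have *: "subdegree H = subdegree G" if "H \<noteq> 0" "H * subst_cube G = subst_cube H * G" for H
  proof -
    have "subdegree H + 3 * subdegree G = 3 * subdegree H + subdegree G"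
      using arg_cong[OF that(2), of subdegree] that(1) assms(2) subst0 by (simp add: sub)
    then show ?thesis by simp
  qed
  define n where "n = subdegree G"
  define c where "c = F $ n / G $ n"
  define H where "H = F - fps_const c * G"
  have "H * subst_cube G = subst_cube H * G"
    using assms(1) by (simp add: H_def algebra_simps fps_compose_sub_distrib subst_cube_mult)
  moreover have "H $ n = 0"
    using assms(2) by (simp add: H_def c_def n_def)
  ultimately have "H = 0" using * nth_subdegree_nonzero n_def by metis
  then show ?thesis by (auto simp: H_def)
qed

section \<open>Multiplicities of zeros under cubing\<close>

definition pcube :: "'a::comm_ring_1 poly \<Rightarrow> 'a poly" where
  "pcube P = pcompose P (monom 1 3)"

lemma fps_of_poly_pcube: "fps_of_poly (pcube P) = subst_cube (fps_of_poly P)" for P :: "'a::idom poly"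
  by (simp add: pcube_def fps_of_poly_pcompose coeff_monom fps_of_poly_monom)

lemma poly_pcube: "poly (pcube P) z = poly P (z ^ 3)"
  by (simp add: pcube_def poly_pcompose poly_monom)

lemma pcube_eq_0_iff: "pcube P = 0 \<longleftrightarrow> P = 0" for P :: "'a::idom poly"
proof -
  have "pcube P = 0 \<longleftrightarrow> subst_cube (fps_of_poly P) = 0"
    unfolding fps_of_poly_pcube[symmetric] by simp
  then show ?thesis by (simp add: fps_compose_eq_0_iff)
qed

lemma pcompose_power: "pcompose (P ^ n) Q = pcompose P Q ^ n" for P :: "'a::comm_semiring_1 poly"
  by (induction n) (simp_all add: pcompose_mult pcompose_1)

text \<open>Cubing is unramified away from 0: in
  \<open>x ^ 3 - z ^ 3 = (x - z) (x ^ 2 + z x + z ^ 2)\<close> the second factor takes the nonzero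
  value \<open>3 * z ^ 2\<close> at \<open>x = z\<close>.\<close>

lemma order_pcube:
  fixes P :: "'a::field_char_0 poly"
  assumes "P \<noteq> 0" "z \<noteq> 0"
  shows "order z (pcube P) = order (z ^ 3) P"
proof -
  define k where "k = order (z ^ 3) P"
  obtain U where U: "P = [:- (z ^ 3), 1:] ^ k * U" "\<not> [:- (z ^ 3), 1:] dvd U"
    using order_decomp[OF assms(1)] unfolding k_def by blast
  have "pcube [:- (z ^ 3), 1:] = [:- z, 1:] * [:z ^ 2, z, 1:]"
    by (simp add: pcube_def pcompose_pCons power2_eq_square power3_eq_cube monom_altdef)
  then have eq: "pcube P = [:- z, 1:] ^ k * ([:z ^ 2, z, 1:] ^ k * pcube U)"
    unfolding U(1) pcube_def pcompose_mult pcompose_power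
    by (simp only: power_mult_distrib mult.assoc)
  have "poly U (z ^ 3) \<noteq> 0" using U(2) by (simp add: poly_eq_0_iff_dvd)
  moreover have "poly [:z ^ 2, z, 1:] z \<noteq> 0"
  proof -
    have "poly [:z ^ 2, z, 1:] z = 3 * z ^ 2" by (simp add: power2_eq_square algebra_simps)
    also have "\<dots> \<noteq> 0" using assms(2) by simp
    finally show ?thesis .
  qed
  ultimately have nz: "poly ([:z ^ 2, z, 1:] ^ k * pcube U) z \<noteq> 0"
    by (simp add: poly_pcube)
  then have "order z (pcube P) = k + order z ([:z ^ 2, z, 1:] ^ k * pcube U)"
    unfolding eq by (subst order_mult) (auto simp: order_power_n_n)
  then show ?thesis using nz by (simp add: order_0I k_def)
qed

text \<open>The nonzero points where the multiplicity of \<open>W\<close> is not divisible by \<open>e\<close> form a finite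
  set that is stable under taking cubes and all cube roots, so it is empty.\<close>
lemma dvd_order_of_pcube_quotient:
  fixes W A B :: "complex poly"
  assumes "A ^ e * pcube W = B ^ e * W" and "A \<noteq> 0" "B \<noteq> 0" "W \<noteq> 0" and "z \<noteq> 0"
  shows "e dvd order z W"
proof -
  define S where "S = {z. z \<noteq> 0 \<and> \<not> e dvd order z W}"
  have ord: "e dvd order (z ^ 3) W \<longleftrightarrow> e dvd order z W" if "z \<noteq> 0" for z
  proof -
    have pw: "order z (H ^ e) = e * order z H" if "H \<noteq> 0" for H :: "complex poly"
      using that by (induction e) (simp_all add: order_mult)
    have "order z (A ^ e * pcube W) = e * order z A + order (z ^ 3) W"
      using assms that by (subst order_mult) (simp_all add: pcube_eq_0_iff order_pcube pw)
    moreover have "order z (B ^ e * W) = e * order z B + order z W"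
      using assms by (subst order_mult) (simp_all add: pw)
    ultimately have "e * order z A + order (z ^ 3) W = e * order z B + order z W"
      using assms(1) by simp
    then show ?thesis by (metis dvd_add_right_iff dvd_triv_left)
  qed
  have fin: "finite S"
  proof (rule finite_subset)
    show "S \<subseteq> {z. poly W z = 0}" unfolding S_def using order_0I by fastforce
    show "finite {z. poly W z = 0}" using assms(4) by (rule poly_roots_finite)
  qed
  have "S \<subseteq> (\<lambda>z. z ^ 3) ` S"
  proof
    fix z assume z: "z \<in> S"
    obtain y where y: "y ^ 3 = z" using nth_root_exists[of 3 z] by auto
    then have "y \<in> S" using z ord[of y] by (auto simp: S_def)
    then show "z \<in> (\<lambda>z. z ^ 3) ` S" using y by blast
  qed
  \<comment> \<open>A finite set contained in its own image has as many images as elements.\<close>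
  then have inj: "inj_on (\<lambda>z. z ^ 3) S"
    using fin by (metis card_image_le card_mono eq_card_imp_inj_on finite_imageI le_antisym)
  define \<omega> where "\<omega> = cis (2 * pi / 3)"
  have "\<omega> ^ 3 = cis (2 * pi)" unfolding \<omega>_def by (subst Complex.DeMoivre) simp
  then have "\<omega> ^ 3 = 1" by simp
  moreover have "\<omega> \<noteq> 1" by (simp add: \<omega>_def complex_eq_iff cos_120)
  ultimately have \<omega>: "\<omega> ^ 3 = 1" "\<omega> \<noteq> 1" .
  have "S = {}"
  proof (rule ccontr)
    assume "S \<noteq> {}"
    then obtain z where z: "z \<in> S" by blast
    \<comment> \<open>Multiplying by a primitive cube root of unity gives a second point of
      \<open>S\<close> with the same cube, which contradicts injectivity.\<close>
    have cube: "(\<omega> * z) ^ 3 = z ^ 3" by (simp add: power_mult_distrib \<omega>)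
    moreover have "\<omega> \<noteq> 0" using \<omega>(1) by auto
    then have "\<omega> * z \<in> S"
      using z ord[of "\<omega> * z"] ord[of z] \<omega> by (auto simp: S_def cube)
    ultimately have "\<omega> * z = z" using inj z by (auto dest: inj_onD)
    then show False using z \<omega> by (simp add: S_def)
  qed
  then show ?thesis using assms(5) by (auto simp: S_def)
qed

text \<open>\<open>W = S * T ^ (e - 1)\<close> is a polynomial equal to \<open>(T F) ^ e\<close>. If
  all its zeros have multiplicity divisible by \<open>e\<close>, then \<open>W\<close> is a constant
  times \<open>H ^ e\<close>, and \<open>T F\<close> is a constant multiple of the polynomial
  \<open>H\<close>.\<close>

lemma rational_of_rational_power:
  fixes F :: "complex fps" and T S C D :: "complex poly"
  assumes fe: "fps_of_poly D * F = fps_of_poly C * subst_cube F"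
    and "C \<noteq> 0" "D \<noteq> 0" "F \<noteq> 0" "T \<noteq> 0" and "e > 0"
    and pow: "fps_of_poly T * F ^ e = fps_of_poly S"
  shows "\<exists>V U. V \<noteq> 0 \<and> fps_of_poly V * F = fps_of_poly U"
proof -
  define W where "W = S * T ^ (e - 1)"
  have W: "fps_of_poly W = (fps_of_poly T * F) ^ e"
    using \<open>e > 0\<close> unfolding W_def fps_of_poly_mult fps_of_poly_power pow[symmetric]
    by (cases e) (simp_all add: power_mult_distrib mult_ac)
  have W0: "W \<noteq> 0"
  proof
    assume "W = 0"
    then have "(fps_of_poly T * F) ^ e = 0" using W by simp
    then show False using assms by simp
  qed
  \<comment> \<open>The \<open>e\<close>-th power of the functional equation, cleared of
    \<open>F\<close> by means of \<open>W\<close>.\<close>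
  have "fps_of_poly ((C * T) ^ e * pcube W) = fps_of_poly ((D * pcube T) ^ e * W)"
  proof -
    have "fps_of_poly ((C * T) ^ e * pcube W) =
      ((fps_of_poly C * subst_cube F) * fps_of_poly T * subst_cube (fps_of_poly T)) ^ e"
      by (simp add: fps_of_poly_mult fps_of_poly_power fps_of_poly_pcube W subst_cube_mult
          power_mult_distrib mult_ac flip: fps_compose_power)
    also have "\<dots> = fps_of_poly ((D * pcube T) ^ e * W)"
      unfolding fe[symmetric]
      by (simp add: fps_of_poly_mult fps_of_poly_power fps_of_poly_pcube W power_mult_distrib mult_ac)
    finally show ?thesis .
  qed
  then have "(C * T) ^ e * pcube W = (D * pcube T) ^ e * W" by (simp only: fps_of_poly_eq_iff)
  then have ord: "e dvd order z W" if "z \<noteq> 0" for z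
    using dvd_order_of_pcube_quotient W0 that assms
    by (metis mult_eq_0_iff pcube_eq_0_iff)
  \<comment> \<open>The argument with cube roots excludes the point 0. There the multiplicity is the
    order of the series \<open>(T F) ^ e\<close>, a multiple of \<open>e\<close>.\<close>
  have ord0: "e dvd order 0 W"
  proof -
    obtain U where U: "W = [:0, 1:] ^ order 0 W * U" "\<not> [:0, 1:] dvd U"
      using order_decomp[OF W0, of 0] by auto
    have "coeff U 0 \<noteq> 0" using U(2) poly_eq_0_iff_dvd[of U 0] by (simp add: poly_0_coeff_0)
    then have "subdegree (fps_of_poly U) = 0" "U \<noteq> 0" by (auto intro: subdegree_eq_0)
    have "fps_of_poly W = fps_X ^ order 0 W * fps_of_poly U"
      by (subst U(1)) (simp add: fps_of_poly_mult fps_of_poly_power fps_of_poly_pCons)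
    moreover have "subdegree (fps_X ^ n * G) = n" if "subdegree G = 0" "G \<noteq> 0" for n and G :: "complex fps"
      using that by simp
    ultimately have "subdegree (fps_of_poly W) = order 0 W"
      using \<open>subdegree (fps_of_poly U) = 0\<close> \<open>U \<noteq> 0\<close> by (metis fps_of_poly_0 fps_of_poly_eq_iff)
    then show ?thesis unfolding W by (metis dvd_triv_left subdegree_power)
  qed
  define H where "H = (\<Prod>z | poly W z = 0. [:- z, 1:] ^ (order z W div e))"
  have "W = Polynomial.smult (lead_coeff W) (\<Prod>z | poly W z = 0. [:- z, 1:] ^ order z W)"
    by (rule complex_poly_decompose[symmetric])
  also have "(\<Prod>z | poly W z = 0. [:- z, 1:] ^ order z W) = H ^ e"
    unfolding H_def prod_power_distrib
  proof (rule prod.cong)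
    fix z
    have "e dvd order z W" using ord ord0 by (cases "z = 0") auto
    then show "[:- z, 1:] ^ order z W = ([:- z, 1:] ^ (order z W div e)) ^ e"
      by (simp flip: power_mult)
  qed simp
  finally have "(fps_of_poly T * F) ^ e = fps_const (lead_coeff W) * fps_of_poly H ^ e"
    unfolding W[symmetric] by (metis fps_of_poly_power fps_of_poly_smult)
  moreover have "H \<noteq> 0"
    unfolding H_def using W0 by (subst prod_zero_iff) (auto simp: poly_roots_finite)
  then have "fps_of_poly H \<noteq> 0" by simp
  ultimately obtain k where "fps_of_poly T * F = fps_const k * fps_of_poly H"
    using fps_power_eq_const_mult_power \<open>e > 0\<close> by blast
  then have "fps_of_poly T * F = fps_of_poly (Polynomial.smult k H)"
    by (simp add: fps_of_poly_smult)
  then show ?thesis using \<open>T \<noteq> 0\<close> by blast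
qed

text \<open>Induction on the length of the relation. Combining it with its image under
  \<open>z\<close> to \<open>z ^ 3\<close> cancels the top coefficients. Either a shorter nontrivial
  relation remains, or the two are proportional; then the quotient of two terms of the relation is
  invariant under the substitution and hence constant, so a power of \<open>F\<close> is
  rational.\<close>

lemma rational_of_algebraic:
  fixes F :: "complex fps" and C D :: "complex poly"
  assumes fe: "fps_of_poly D * F = fps_of_poly C * subst_cube F"
    and "C \<noteq> 0" "D \<noteq> 0" "F \<noteq> 0"
    and "i \<le> L" "P i \<noteq> 0" and "(\<Sum>i\<le>L. fps_of_poly (P i) * F ^ i) = 0"
  shows "\<exists>V U. V \<noteq> 0 \<and> fps_of_poly V * F = fps_of_poly U"
  using assms(5-7)
proof (induction L arbitrary: P i)
  case 0
  then show ?case by simp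
next
  case (Suc L)
  let ?rel = "\<lambda>L P. (\<Sum>i\<le>L. fps_of_poly (P i) * F ^ i)"
  show ?case
  proof (cases "P (Suc L) = 0")
    case True
    then have "?rel L P = 0" "i \<le> L" using Suc.prems by (auto simp: le_Suc_eq)
    then show ?thesis using Suc.IH Suc.prems(2) by blast
  next
    case top: False
    \<comment> \<open>The relation after \<open>z\<close> to \<open>z ^ 3\<close>, with
      \<open>F(z ^ 3) = (D / C) F\<close> inserted and multiplied by \<open>C ^ Suc L\<close> to
      clear denominators.\<close>
    define Q where "Q i = pcube (P i) * (D ^ i * C ^ (Suc L - i))" for i
    have relQ: "?rel (Suc L) Q = 0"
    proof -
      have "fps_of_poly (Q i) * F ^ i = fps_of_poly C ^ Suc L * subst_cube (fps_of_poly (P i) * F ^ i)"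
        if "i \<le> Suc L" for i
      proof -
        have "fps_of_poly (Q i) * F ^ i = subst_cube (fps_of_poly (P i)) * (fps_of_poly D * F) ^ i
            * fps_of_poly C ^ (Suc L - i)"
          by (simp add: Q_def fps_of_poly_mult fps_of_poly_power fps_of_poly_pcube power_mult_distrib mult_ac)
        also have "\<dots> = subst_cube (fps_of_poly (P i) * F ^ i) * (fps_of_poly C ^ i * fps_of_poly C ^ (Suc L - i))"
          unfolding fe by (simp add: power_mult_distrib subst_cube_mult mult_ac flip: fps_compose_power)
        finally show ?thesis using that by (simp add: mult.commute flip: power_add)
      qed
      then have "?rel (Suc L) Q = fps_of_poly C ^ Suc L * subst_cube (?rel (Suc L) P)"
        unfolding fps_compose_sum_distrib sum_distrib_left by (intro sum.cong) auto
      then show ?thesis using Suc.prems(3) by simp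
    qed
    \<comment> \<open>Cross-multiplication with the leading coefficients makes the term of index
      \<open>Suc L\<close> vanish.\<close>
    define R where "R i = P (Suc L) * Q i - Q (Suc L) * P i" for i
    have "?rel (Suc L) R = fps_of_poly (P (Suc L)) * ?rel (Suc L) Q - fps_of_poly (Q (Suc L)) * ?rel (Suc L) P"
      unfolding sum_distrib_left sum_subtractf[symmetric]
      by (intro sum.cong refl) (simp add: R_def fps_of_poly_mult fps_of_poly_diff algebra_simps)
    then have "?rel (Suc L) R = 0" using relQ Suc.prems(3) by simp
    then have relR: "?rel L R = 0" by (simp add: R_def)
    show ?thesis
    proof (cases "\<exists>i\<le>L. R i \<noteq> 0")
      case True
      then show ?thesis using Suc.IH relR by blast
    next
      case False
      obtain i where i: "i \<le> L" "P i \<noteq> 0"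
      proof -
        have "\<exists>i\<le>L. P i \<noteq> 0"
        proof (rule ccontr)
          assume "\<not> ?thesis"
          then have "?rel (Suc L) P = fps_of_poly (P (Suc L)) * F ^ Suc L" by simp
          then show False using Suc.prems(3) top \<open>F \<noteq> 0\<close> by simp
        qed
        then show thesis using that by blast
      qed
      define e where "e = Suc L - i"
      have e: "e > 0" "Suc L = i + e" using i by (auto simp: e_def)
      have "P (Suc L) * Q i = Q (Suc L) * P i" using False i by (simp add: R_def)
      then have "D ^ i * (P (Suc L) * pcube (P i) * C ^ e) = D ^ i * (pcube (P (Suc L)) * D ^ e * P i)"
        unfolding Q_def e_def[symmetric] by (simp add: e(2) power_add mult_ac)
      then have rel: "P (Suc L) * pcube (P i) * C ^ e = pcube (P (Suc L)) * D ^ e * P i"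
        using \<open>D \<noteq> 0\<close> by simp
      let ?D = "fps_of_poly D" and ?C = "fps_of_poly C"
      let ?A = "fps_of_poly (P (Suc L))" and ?B = "fps_of_poly (P i)"
      have rel': "?A * subst_cube ?B * ?C ^ e = subst_cube ?A * ?D ^ e * ?B"
        using arg_cong[OF rel, of fps_of_poly]
        by (simp add: fps_of_poly_mult fps_of_poly_power fps_of_poly_pcube)
      \<comment> \<open>Proportionality means that \<open>?A * F ^ e / ?B\<close> does not change
        under \<open>z\<close> to \<open>z ^ 3\<close>; the equation is stated without
        denominators.\<close>
      have "?D ^ e * ((?A * F ^ e) * subst_cube ?B) = ?A * subst_cube ?B * (?D * F) ^ e"
        by (simp add: power_mult_distrib mult_ac)
      also have "\<dots> = (?A * subst_cube ?B * ?C ^ e) * subst_cube F ^ e"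
        unfolding fe by (simp add: power_mult_distrib mult_ac)
      also have "\<dots> = ?D ^ e * (subst_cube (?A * F ^ e) * ?B)"
        unfolding rel' by (simp add: subst_cube_mult mult_ac flip: fps_compose_power)
      finally have "(?A * F ^ e) * subst_cube ?B = subst_cube (?A * F ^ e) * ?B"
        using \<open>D \<noteq> 0\<close> by simp
      moreover have "?B \<noteq> 0" using i by simp
      ultimately obtain c where "?A * F ^ e = fps_const c * ?B"
        using subst_cube_proportional by blast
      then have "?A * F ^ e = fps_of_poly (Polynomial.smult c (P i))" by (simp add: fps_of_poly_smult)
      then show ?thesis using rational_of_rational_power[OF fe] assms(2-4) top e(1) by blast
    qed
  qed
qed


subsection \<open>Values along the orbit of \<open>1/b\<close>\<close>

definition ev :: "int poly \<Rightarrow> real \<Rightarrow> real" where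
  "ev P x = poly (map_poly real_of_int P) x"

lemma ev_0 [simp]: "ev 0 x = 0"
  by (simp add: ev_def)

lemma ev_1 [simp]: "ev 1 x = 1"
  by (simp add: ev_def)

lemma ev_pCons: "ev (pCons a P) x = of_int a + x * ev P x"
  by (simp add: ev_def map_poly_pCons)

lemma ev_add: "ev (P + Q) x = ev P x + ev Q x"
  by (induction P Q rule: poly_induct2) (simp_all add: ev_pCons algebra_simps)

lemma ev_smult: "ev (Polynomial.smult c P) x = of_int c * ev P x"
  by (induction P) (simp_all add: ev_pCons algebra_simps)

lemma ev_mult: "ev (P * Q) x = ev P x * ev Q x"
  by (induction P) (simp_all add: ev_pCons ev_add ev_smult algebra_simps)

lemma ev_diff: "ev (P - Q) x = ev P x - ev Q x"
  using ev_add[of "P - Q" Q x] by simp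

lemma ev_power: "ev (P ^ n) x = ev P x ^ n"
  by (induction n) (simp_all add: ev_mult)

lemma ev_sum: "ev (\<Sum>i\<in>A. P i) x = (\<Sum>i\<in>A. ev (P i) x)"
  by (induction A rule: infinite_finite_induct) (simp_all add: ev_add)

lemma ev_monom: "ev (monom c n) x = of_int c * x ^ n"
  by (simp add: ev_def map_poly_monom poly_monom)

lemma ev_pcube: "ev (pcube P) x = ev P (x ^ 3)"
  by (induction P) (simp_all add: pcube_def pcompose_pCons ev_pCons ev_add ev_mult ev_monom)

lemma ev_altdef: "degree P \<le> M \<Longrightarrow> ev P x = (\<Sum>j\<le>M. of_int (coeff P j) * x ^ j)"
  unfolding ev_def poly_altdef
  by (intro sum.mono_neutral_cong_left)
     (auto simp: coeff_map_poly degree_map_poly coeff_eq_0)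

lemma ev_0_right: "ev P 0 = of_int (coeff P 0)"
  by (simp add: ev_def poly_0_coeff_0 coeff_map_poly)

lemma tendsto_ev:
  assumes "f \<longlonglongrightarrow> x"
  shows "(\<lambda>n. ev P (f n)) \<longlonglongrightarrow> ev P x"
  unfolding ev_def using assms by (rule tendsto_poly)

lemma tendsto_ev_divide_power:
  fixes f :: "nat \<Rightarrow> real"
  assumes "f \<longlonglongrightarrow> 0" and "\<And>n. f n \<noteq> 0" and "\<And>j. j < h \<Longrightarrow> coeff P j = 0"
  shows "(\<lambda>n. ev P (f n) / f n ^ h) \<longlonglongrightarrow> of_int (coeff P h)"
proof -
  have "P = monom 1 h * poly_shift h P"
    by (rule poly_eqI) (auto simp: coeff_monom_mult coeff_poly_shift assms(3))
  then have "ev P (f n) = ev (monom 1 h * poly_shift h P) (f n)" for n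
    by simp
  then have "ev P (f n) = f n ^ h * ev (poly_shift h P) (f n)" for n
    by (simp add: ev_mult ev_monom)
  then have "(\<lambda>n. ev P (f n) / f n ^ h) = (\<lambda>n. ev (poly_shift h P) (f n))"
    using assms(2) by simp
  moreover have "(\<lambda>n. ev (poly_shift h P) (f n)) \<longlonglongrightarrow> of_int (coeff P h)"
    using tendsto_ev[OF assms(1), of "poly_shift h P"] by (simp add: ev_0_right coeff_poly_shift)
  ultimately show ?thesis by simp
qed

definition fps_trunc :: "nat \<Rightarrow> int fps \<Rightarrow> int poly" where
  "fps_trunc K F = (\<Sum>j<K. monom (F $ j) j)"

lemma coeff_fps_trunc: "coeff (fps_trunc K F) j = (if j < K then F $ j else 0)"
  by (simp add: fps_trunc_def coeff_sum coeff_monom)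

lemma fps_power_nth_cong:
  fixes F G :: "'a::comm_ring_1 fps"
  assumes "\<And>j. j \<le> k \<Longrightarrow> F $ j = G $ j"
  shows "j \<le> k \<Longrightarrow> (F ^ n) $ j = (G ^ n) $ j"
proof (induction n arbitrary: j)
  case 0
  then show ?case by simp
next
  case (Suc n)
  then show ?case using assms by (auto simp: fps_mult_nth intro!: sum.cong)
qed

lemma tendsto_imp_bounded:
  fixes f :: "nat \<Rightarrow> real"
  assumes "f \<longlonglongrightarrow> l"
  shows "\<exists>B. \<forall>n. \<bar>f n\<bar> \<le> B"
  using convergent_imp_Bseq[OF convergentI[OF assms]] unfolding Bseq_def real_norm_def by blast

text \<open>The constant is the geometric sum \<open>1 + 1/2 + 1/4 + ... = 2\<close>. Instead of
  summing, \<open>\<bar>v n\<bar> - 2 * B * x n\<close> is seen to increase towards its limit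
  0.\<close>

lemma telescoping_bound:
  fixes v x :: "nat \<Rightarrow> real"
  assumes "v \<longlonglongrightarrow> 0" "x \<longlonglongrightarrow> 0" and "\<And>n. x (Suc n) \<le> x n / 2"
    and "\<And>n. \<bar>v n - v (Suc n)\<bar> \<le> B * x n" and "B \<ge> 0"
  shows "\<bar>v n\<bar> \<le> 2 * B * x n"
proof -
  define w where "w n = \<bar>v n\<bar> - 2 * B * x n" for n
  have "incseq w"
  proof (rule incseq_SucI)
    fix n
    have "B * x (Suc n) \<le> B * (x n / 2)" using assms(3,5) by (intro mult_left_mono)
    then show "w n \<le> w (Suc n)" using assms(4)[of n] unfolding w_def by linarith
  qed
  moreover have "w \<longlonglongrightarrow> \<bar>0\<bar> - 2 * B * 0"
    unfolding w_def by (intro tendsto_intros assms)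
  ultimately have "w n \<le> 0" using incseq_le[of w] by simp
  then show ?thesis by (simp add: w_def)
qed

section \<open>The infinite product and its tails at the points \<open>X m\<close>\<close>

locale mahler_point =
  fixes C D :: "int poly" and b :: int
  assumes C0: "poly C 0 = 1" and D0: "poly D 0 = 1" and b: "b \<ge> 2"
    and nonzero: "\<And>m. ev C (1 / real_of_int b ^ (3 ^ m)) * ev D (1 / real_of_int b ^ (3 ^ m)) \<noteq> 0"
begin

abbreviation "f \<equiv> mahler_fps C D"
abbreviation "\<xi> \<equiv> mahler_value C D b"

definition Y :: "nat \<Rightarrow> real" where "Y n = real_of_int b ^ (3 ^ n)"
definition X :: "nat \<Rightarrow> real" where "X n = 1 / Y n"

lemma Y_pos: "Y n > 0" and X_pos: "X n > 0"
  using b by (simp_all add: X_def Y_def)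

lemma X_neq_0: "X n \<noteq> 0"
  using X_pos[of n] by simp

lemma X_Suc: "X (Suc n) = X n ^ 3"
  by (simp add: X_def Y_def power_divide mult.commute flip: power_mult)

lemma X_le_half: "X n \<le> 1 / 2"
proof -
  have "2 \<le> real_of_int b" using b by simp
  also have "\<dots> = real_of_int b ^ 1" by simp
  also have "\<dots> \<le> Y n" unfolding Y_def using b by (intro power_increasing) auto
  finally show ?thesis using b by (simp add: X_def field_simps)
qed

lemma X_Suc_le: "X (Suc n) \<le> X n / 2"
proof -
  have "X n ^ 2 \<le> X n ^ 1"
    using X_pos[of n] X_le_half[of n] by (intro power_decreasing) auto
  then have "X n ^ 2 \<le> 1 / 2" using X_le_half[of n] by simp
  then have "X n * X n ^ 2 \<le> X n * (1 / 2)" using X_pos[of n] by (intro mult_left_mono) auto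
  then show ?thesis by (simp add: X_Suc power3_eq_cube power2_eq_square)
qed

lemma X_le_power: "X n \<le> (1 / 2) ^ n"
proof (induction n)
  case 0
  then show ?case using X_le_half[of 0] by simp
next
  case (Suc n)
  then show ?case using X_Suc_le[of n] by simp
qed

lemma X_tendsto: "X \<longlonglongrightarrow> 0"
proof (rule tendsto_sandwich[of "\<lambda>_. 0" X sequentially "\<lambda>n. (1 / 2) ^ n"])
  show "(\<lambda>n. (1 / 2 :: real) ^ n) \<longlonglongrightarrow> 0" by (intro LIMSEQ_power_zero) auto
  show "\<forall>\<^sub>F n in sequentially. 0 \<le> X n" "\<forall>\<^sub>F n in sequentially. X n \<le> (1 / 2) ^ n"
    using X_pos X_le_power by (auto intro!: always_eventually less_imp_le)
qed simp

lemma summable_X: "summable X"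
  using X_pos X_le_power
  by (intro summable_comparison_test'[of "\<lambda>n. (1 / 2) ^ n" 0 X] summable_geometric)
     (auto simp: less_imp_le)

lemma ev_nonzero: "ev C (X n) \<noteq> 0" "ev D (X n) \<noteq> 0"
  using nonzero[of n] by (simp_all add: X_def Y_def)

text \<open>Since \<open>P(0) = 1\<close>, the deviation of \<open>P (X n)\<close> from 1 is
  \<open>O(X n)\<close>, which is summable. The limit is nonzero because no factor vanishes.\<close>

lemma has_prod_ev:
  assumes "poly P 0 = 1" "\<And>n. ev P (X n) \<noteq> 0"
  shows "\<exists>l. l \<noteq> 0 \<and> (\<lambda>n. ev P (X n)) has_prod l"
proof -
  have "(\<lambda>n. ev (P - 1) (X n) / X n ^ 1) \<longlonglongrightarrow> of_int (coeff (P - 1) 1)"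
    using assms(1) by (intro tendsto_ev_divide_power X_tendsto X_neq_0) (simp add: poly_0_coeff_0)
  then obtain B where B: "\<And>n. \<bar>ev (P - 1) (X n) / X n ^ 1\<bar> \<le> B"
    using tendsto_imp_bounded by blast
  have bound: "norm (ev P (X n) - 1) \<le> B * X n" for n
  proof -
    have "norm (ev P (X n) - 1) = \<bar>ev (P - 1) (X n) / X n ^ 1\<bar> * X n"
      using X_pos[of n] by (simp add: ev_diff abs_divide)
    also have "\<dots> \<le> B * X n"
      using B[of n] X_pos[of n] by (intro mult_right_mono) auto
    finally show ?thesis .
  qed
  have "summable (\<lambda>n. norm (ev P (X n) - 1))"
  proof (rule summable_comparison_test')
    show "summable (\<lambda>n. B * X n)" using summable_X by (rule summable_mult)
    show "norm (norm (ev P (X n) - 1)) \<le> B * X n" if "n \<ge> 0" for n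
      using bound[of n] by simp
  qed
  then have conv: "convergent_prod (\<lambda>n. ev P (X n))"
    by (intro abs_convergent_prod_imp_convergent_prod summable_imp_abs_convergent_prod)
  then have "(\<lambda>n. ev P (X n)) has_prod prodinf (\<lambda>n. ev P (X n))"
    by (rule convergent_prod_has_prod)
  moreover have "prodinf (\<lambda>n. ev P (X n)) \<noteq> 0"
    using conv assms(2) by (rule prodinf_nonzero)
  ultimately show ?thesis by blast
qed

definition num :: "nat \<Rightarrow> real" where "num m = (\<Prod>n<m. ev C (X n))"
definition den :: "nat \<Rightarrow> real" where "den m = (\<Prod>n<m. ev D (X n))"
text \<open>This is \<open>f(X m)\<close>: iterating the functional equation gives
  \<open>\<xi> = num m / den m * f(X m)\<close>. Defined through finite products, it makes sense
  without summing the power series at \<open>X m\<close>.\<close>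

definition \<Phi> :: "nat \<Rightarrow> real" where "\<Phi> m = \<xi> * den m / num m"

lemma num_den_neq_0: "num m \<noteq> 0" "den m \<noteq> 0"
  using ev_nonzero by (simp_all add: num_def den_def)

lemma num_den_tendsto:
  obtains lC lD where "lC \<noteq> 0" "lD \<noteq> 0" "num \<longlonglongrightarrow> lC" "den \<longlonglongrightarrow> lD" "\<xi> = lC / lD"
proof -
  obtain lC where lC: "lC \<noteq> 0" "(\<lambda>n. ev C (X n)) has_prod lC"
    using has_prod_ev[OF C0 ev_nonzero(1)] by blast
  obtain lD where lD: "lD \<noteq> 0" "(\<lambda>n. ev D (X n)) has_prod lD"
    using has_prod_ev[OF D0 ev_nonzero(2)] by blast
  have "(\<lambda>n. ev C (X n) / ev D (X n)) has_prod (lC / lD)"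
    using lC lD by (intro has_prod_divide)
  then have "\<xi> = lC / lD"
    by (simp add: mahler_value_def ev_def X_def Y_def has_prod_unique[symmetric])
  moreover have "num \<longlonglongrightarrow> lC"
    using has_prod_imp_tendsto[OF lC(2)] unfolding num_def LIMSEQ_lessThan_iff_atMost .
  moreover have "den \<longlonglongrightarrow> lD"
    using has_prod_imp_tendsto[OF lD(2)] unfolding den_def LIMSEQ_lessThan_iff_atMost .
  ultimately show thesis using that lC(1) lD(1) by blast
qed

lemma xi_neq_0: "\<xi> \<noteq> 0"
  using num_den_tendsto by (metis divide_eq_0_iff)

lemma \<Phi>_neq_0: "\<Phi> m \<noteq> 0"
  using xi_neq_0 num_den_neq_0 by (simp add: \<Phi>_def)

lemma \<Phi>_tendsto: "\<Phi> \<longlonglongrightarrow> 1"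
proof -
  obtain lC lD where l: "lC \<noteq> 0" "lD \<noteq> 0" "num \<longlonglongrightarrow> lC" "den \<longlonglongrightarrow> lD" "\<xi> = lC / lD"
    by (rule num_den_tendsto)
  have "\<Phi> \<longlonglongrightarrow> \<xi> * lD / lC"
    unfolding \<Phi>_def by (intro tendsto_intros l)
  then show ?thesis using l by simp
qed

lemma \<Phi>_Suc: "\<Phi> (Suc n) * ev C (X n) = \<Phi> n * ev D (X n)"
  using ev_nonzero[of n] num_den_neq_0[of n] by (simp add: \<Phi>_def num_def den_def field_simps)

text \<open>The truncation \<open>p\<close> satisfies the functional equation up to \<open>O(z\<^sup>K)\<close>, so the quotients
  \<open>p(X n) / \<Phi> n\<close>, which tend to 1, change only by \<open>O((X n)\<^sup>K)\<close> at each step.\<close>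
lemma \<Phi>_approx:
  assumes "K > 0"
  shows "\<exists>B. \<forall>m. \<bar>\<Phi> m - ev (fps_trunc K f) (X m)\<bar> \<le> B * X m ^ K"
proof -
  define p where "p = fps_trunc K f"
  define R where "R = D * p - C * pcube p"
  have "coeff R j = 0" if "j < K" for j
  proof -
    have "(fps_of_poly D * fps_of_poly p) $ j = (fps_of_poly D * f) $ j"
      using that by (intro fps_mult_nth_cong) (simp add: p_def coeff_fps_trunc)
    moreover have "(fps_of_poly C * subst_cube (fps_of_poly p)) $ j = (fps_of_poly C * subst_cube f) $ j"
      using that by (intro fps_mult_nth_cong) (auto simp: p_def coeff_fps_trunc fps_compose_nth intro!: sum.cong)
    moreover have "coeff R j = (fps_of_poly D * fps_of_poly p) $ j - (fps_of_poly C * subst_cube (fps_of_poly p)) $ j"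
      unfolding R_def fps_of_poly_pcube[symmetric] fps_of_poly_mult[symmetric] by simp
    ultimately show ?thesis using mahler_functional_equation[OF C0 D0] by simp
  qed
  then have "(\<lambda>n. ev R (X n) / X n ^ K) \<longlonglongrightarrow> of_int (coeff R K)"
    by (intro tendsto_ev_divide_power X_tendsto X_neq_0)
  moreover have "(\<lambda>n. ev D (X n)) \<longlonglongrightarrow> ev D 0"
    by (intro tendsto_ev X_tendsto)
  then have "(\<lambda>n. ev D (X n)) \<longlonglongrightarrow> 1" using D0 by (simp add: ev_0_right poly_0_coeff_0)
  ultimately have "(\<lambda>n. (ev R (X n) / X n ^ K) / (ev D (X n) * \<Phi> n)) \<longlonglongrightarrow> of_int (coeff R K) / (1 * 1)"
    using \<Phi>_tendsto by (intro tendsto_divide tendsto_mult) auto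
  then obtain B where B: "\<And>n. \<bar>(ev R (X n) / X n ^ K) / (ev D (X n) * \<Phi> n)\<bar> \<le> B"
    using tendsto_imp_bounded by blast
  have B0: "B \<ge> 0" using B[of 0] by linarith
  define v where "v n = ev p (X n) / \<Phi> n - 1" for n
  have "coeff p 0 = 1" using assms mahler_fps_nth_0[OF C0 D0] by (simp add: p_def coeff_fps_trunc)
  then have "(\<lambda>n. ev p (X n)) \<longlonglongrightarrow> 1"
    using tendsto_ev[OF X_tendsto, of p] by (simp add: ev_0_right)
  then have "v \<longlonglongrightarrow> 1 / 1 - 1"
    unfolding v_def using \<Phi>_tendsto by (intro tendsto_intros) auto
  then have v: "v \<longlonglongrightarrow> 0" by simp
  have step: "\<bar>v n - v (Suc n)\<bar> \<le> B * X n ^ K" for n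
  proof -
    have "\<Phi> (Suc n) = \<Phi> n * ev D (X n) / ev C (X n)"
      using \<Phi>_Suc[of n] ev_nonzero[of n] by (simp add: field_simps)
    then have "v n - v (Suc n) = ev p (X n) / \<Phi> n - ev p (X n ^ 3) * ev C (X n) / (\<Phi> n * ev D (X n))"
      by (simp add: v_def X_Suc)
    also have "\<dots> = ev R (X n) / (ev D (X n) * \<Phi> n)"
      using \<Phi>_neq_0[of n] ev_nonzero[of n]
      by (simp add: R_def ev_diff ev_mult ev_pcube diff_divide_distrib mult.commute)
    finally have "v n - v (Suc n) = ((ev R (X n) / X n ^ K) / (ev D (X n) * \<Phi> n)) * X n ^ K"
      using X_neq_0[of n] by simp
    then have "\<bar>v n - v (Suc n)\<bar> = \<bar>(ev R (X n) / X n ^ K) / (ev D (X n) * \<Phi> n)\<bar> * X n ^ K"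
      using X_pos[of n] by (simp add: abs_mult)
    also have "\<dots> \<le> B * X n ^ K"
      using B[of n] X_pos[of n] by (intro mult_right_mono) auto
    finally show ?thesis .
  qed
  have Xpow: "X (Suc n) ^ K \<le> X n ^ K / 2" for n
  proof -
    have "X (Suc n) ^ K \<le> (X n / 2) ^ K" using X_Suc_le X_pos by (intro power_mono) (auto intro: less_imp_le)
    also have "\<dots> = X n ^ K * (1 / 2) ^ K" by (simp add: power_divide)
    also have "\<dots> \<le> X n ^ K * (1 / 2) ^ 1"
      using X_pos[of n] assms by (intro mult_left_mono power_decreasing) auto
    finally show ?thesis by simp
  qed
  have "(\<lambda>n. X n ^ K) \<longlonglongrightarrow> 0 ^ K" by (intro tendsto_intros X_tendsto)
  then have "(\<lambda>n. X n ^ K) \<longlonglongrightarrow> 0" using assms by (simp add: power_0_left)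
  then have vb: "\<bar>v n\<bar> \<le> 2 * B * X n ^ K" for n
    using telescoping_bound[OF v _ Xpow step B0] by blast
  obtain B' where B': "\<And>n. \<bar>\<Phi> n\<bar> \<le> B'"
    using tendsto_imp_bounded[OF \<Phi>_tendsto] by blast
  have "\<bar>\<Phi> m - ev p (X m)\<bar> \<le> (B' * (2 * B)) * X m ^ K" for m
  proof -
    have "\<Phi> m - ev p (X m) = - (\<Phi> m * v m)" using \<Phi>_neq_0[of m] by (simp add: v_def field_simps)
    then have "\<bar>\<Phi> m - ev p (X m)\<bar> = \<bar>\<Phi> m\<bar> * \<bar>v m\<bar>" by (simp add: abs_mult)
    also have "\<dots> \<le> B' * (2 * B * X m ^ K)"
      using B'[of m] vb[of m] by (intro mult_mono) auto
    finally show ?thesis by (simp add: mult_ac)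
  qed
  then show ?thesis unfolding p_def by blast
qed

text \<open>Replace \<open>f\<close> by its truncation beyond order \<open>h\<close>. The resulting
  polynomial has the coefficients of \<open>E\<close> up to \<open>h\<close>, and exchanging
  \<open>\<Phi> m\<close> for the truncation costs \<open>O(X m ^ (h + 1))\<close>, which disappears
  after division by \<open>X m ^ h\<close>.\<close>

lemma evaluate_relation:
  fixes P :: "nat \<Rightarrow> int poly" and L h :: nat
  defines "E \<equiv> (\<Sum>i\<le>L. fps_of_poly (P i) * f ^ i)"
  assumes low: "\<And>j. j < h \<Longrightarrow> fps_nth E j = 0"
  shows "(\<lambda>m. (\<Sum>i\<le>L. ev (P i) (X m) * \<Phi> m ^ i) / X m ^ h) \<longlonglongrightarrow> of_int (fps_nth E h)"
proof -
  define p where "p = fps_trunc (Suc h) f"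
  define Ep where "Ep = (\<Sum>i\<le>L. P i * p ^ i)"
  have coeff_Ep: "coeff Ep j = fps_nth E j" if "j \<le> h" for j
  proof -
    have "coeff Ep j = (\<Sum>i\<le>L. (fps_of_poly (P i) * fps_of_poly p ^ i) $ j)"
      by (simp add: Ep_def coeff_sum flip: fps_of_poly_power fps_of_poly_mult)
    also have "\<dots> = (\<Sum>i\<le>L. (fps_of_poly (P i) * f ^ i) $ j)"
    proof (intro sum.cong refl fps_mult_nth_cong)
      fix i k assume "k \<le> j"
      show "(fps_of_poly p ^ i) $ k = (f ^ i) $ k"
        by (rule fps_power_nth_cong[of k]) (use \<open>k \<le> j\<close> that in \<open>auto simp: p_def coeff_fps_trunc\<close>)
    qed
    finally show ?thesis by (simp add: E_def fps_sum_nth)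
  qed
  obtain B where B: "\<And>m. \<bar>\<Phi> m - ev p (X m)\<bar> \<le> B * X m ^ Suc h"
    using \<Phi>_approx[of "Suc h"] unfolding p_def by blast
  have diff: "(\<lambda>m. (\<Phi> m - ev p (X m)) / X m ^ h) \<longlonglongrightarrow> 0"
  proof (rule Lim_null_comparison)
    show "(\<lambda>m. B * X m) \<longlonglongrightarrow> 0" by (rule tendsto_mult_right_zero[OF X_tendsto])
    have "norm ((\<Phi> m - ev p (X m)) / X m ^ h) \<le> B * X m" for m
    proof -
      have "norm ((\<Phi> m - ev p (X m)) / X m ^ h) = \<bar>\<Phi> m - ev p (X m)\<bar> / X m ^ h"
        using X_pos[of m] by (simp add: abs_divide)
      also have "\<dots> \<le> (B * X m ^ Suc h) / X m ^ h"
        using B[of m] X_pos[of m] by (intro divide_right_mono) auto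
      also have "\<dots> = B * X m" using X_pos[of m] by simp
      finally show ?thesis .
    qed
    then show "\<forall>\<^sub>F m in sequentially. norm ((\<Phi> m - ev p (X m)) / X m ^ h) \<le> B * X m"
      by (intro always_eventually allI)
  qed
  have p_lim: "(\<lambda>m. ev p (X m)) \<longlonglongrightarrow> ev p 0" by (intro tendsto_ev X_tendsto)
  have split: "(\<Sum>i\<le>L. ev (P i) (X m) * \<Phi> m ^ i) / X m ^ h = ev Ep (X m) / X m ^ h +
      (\<Sum>i\<le>L. ev (P i) (X m) * ((\<Phi> m - ev p (X m)) / X m ^ h *
        (\<Sum>k<i. ev p (X m) ^ (i - Suc k) * \<Phi> m ^ k)))" for m
  proof -
    have "(\<Sum>i\<le>L. ev (P i) (X m) * \<Phi> m ^ i) - ev Ep (X m)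
      = (\<Sum>i\<le>L. ev (P i) (X m) * (\<Phi> m ^ i - ev p (X m) ^ i))"
      by (simp add: Ep_def ev_sum ev_mult ev_power right_diff_distrib sum_subtractf)
    also have "\<dots> = (\<Sum>i\<le>L. ev (P i) (X m) * ((\<Phi> m - ev p (X m)) *
        (\<Sum>k<i. ev p (X m) ^ (i - Suc k) * \<Phi> m ^ k)))"
      by (simp only: power_diff_sumr2)
    finally have "(\<Sum>i\<le>L. ev (P i) (X m) * \<Phi> m ^ i) = ev Ep (X m) + \<dots>" by simp
    then show ?thesis by (simp add: add_divide_distrib sum_divide_distrib)
  qed
  have "(\<lambda>m. ev Ep (X m) / X m ^ h) \<longlonglongrightarrow> of_int (coeff Ep h)"
    using low coeff_Ep by (intro tendsto_ev_divide_power X_tendsto X_neq_0) simp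
  moreover have "(\<lambda>m. \<Sum>i\<le>L. ev (P i) (X m) * ((\<Phi> m - ev p (X m)) / X m ^ h *
        (\<Sum>k<i. ev p (X m) ^ (i - Suc k) * \<Phi> m ^ k))) \<longlonglongrightarrow>
      (\<Sum>i\<le>L. ev (P i) 0 * (0 * (\<Sum>k<i. ev p 0 ^ (i - Suc k) * 1 ^ k)))"
    by (intro tendsto_intros diff \<Phi>_tendsto p_lim tendsto_ev X_tendsto)
  ultimately have "(\<lambda>m. (\<Sum>i\<le>L. ev (P i) (X m) * \<Phi> m ^ i) / X m ^ h) \<longlonglongrightarrow>
     of_int (coeff Ep h) + (\<Sum>i\<le>L. ev (P i) 0 * (0 * (\<Sum>k<i. ev p 0 ^ (i - Suc k) * 1 ^ k)))"
    unfolding split by (rule tendsto_add)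
  then show ?thesis by (simp add: coeff_Ep)
qed

section \<open>Integer linear forms in the powers of \<xi>\<close>

lemma Ints_ev:
  assumes "degree P \<le> M"
  shows "Y m ^ M * ev P (X m) \<in> \<int>"
proof -
  have "Y m ^ M * ev P (X m) = (\<Sum>j\<le>M. of_int (coeff P j) * Y m ^ (M - j))"
    unfolding ev_altdef[OF assms] sum_distrib_left
    using Y_pos[of m] by (intro sum.cong) (auto simp: X_def power_divide power_diff field_simps)
  also have "\<dots> \<in> \<int>" by (auto simp: Y_def)
  finally show ?thesis .
qed

text \<open>One power \<open>Y m ^ d\<close> clears the denominators of all \<open>m\<close> factors
  because \<open>1 + 3 + ... + 3 ^ (m - 1) < 3 ^ m\<close>. In the induction step
  \<open>Y m ^ 3\<close> pays for the old product and the new factor, with one \<open>Y m\<close> to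
  spare. Thus the finite products cost no more than a single evaluation at
  \<open>X m\<close>.\<close>

lemma Ints_prod_ev:
  assumes "degree P \<le> d"
  shows "Y m ^ d * (\<Prod>n<m. ev P (X n)) \<in> \<int>"
proof (induction m)
  case 0
  then show ?case by (auto simp: Y_def)
next
  case (Suc m)
  have "Y (Suc m) = Y m ^ 3"
    by (simp add: Y_def mult.commute flip: power_mult)
  then have "Y (Suc m) = Y m * (Y m * Y m)"
    by (simp add: power3_eq_cube)
  then have "Y (Suc m) ^ d * (\<Prod>n<Suc m. ev P (X n)) =
    Y m ^ d * ((Y m ^ d * (\<Prod>n<m. ev P (X n))) * (Y m ^ d * ev P (X m)))"
    by (simp add: power_mult_distrib mult_ac)
  moreover have "Y m ^ d \<in> \<int>" by (auto simp: Y_def)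
  ultimately show ?case using Suc Ints_ev[OF assms, of m] by (metis Ints_mult)
qed

text \<open>Multiplying the relation at \<open>X m\<close> by \<open>num m ^ L\<close> turns each
  power of \<open>\<Phi> m\<close> into a power of \<open>\<xi>\<close> times \<open>L\<close>
  factors \<open>num m\<close> or \<open>den m\<close>. Denominators cost \<open>Y m ^ M\<close> for
  the polynomials and \<open>Y m ^ d\<close> for each such factor. Up to this scaling, the form
  divided by \<open>X m ^ h\<close> has a nonzero limit, hence the bounds from both sides.\<close>

lemma integer_forms:
  fixes P :: "nat \<Rightarrow> int poly" and L M d h :: nat
  defines "E \<equiv> (\<Sum>i\<le>L. fps_of_poly (P i) * f ^ i)"
  assumes "degree C \<le> d" "degree D \<le> d" and degP: "\<And>i. i \<le> L \<Longrightarrow> degree (P i) \<le> M"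
    and "E \<noteq> 0" and h: "h = subdegree E"
  shows "\<exists>c B. c > 0 \<and> (\<forall>\<^sub>F m in sequentially. \<exists>g :: nat \<Rightarrow> int.
    (\<forall>i\<le>L. \<bar>of_int (g i)\<bar> \<le> B * Y m ^ (M + L * d)) \<and>
    c * Y m ^ (M + L * d) / Y m ^ h \<le> \<bar>\<Sum>i\<le>L. of_int (g i) * \<xi> ^ i\<bar> \<and>
    \<bar>\<Sum>i\<le>L. of_int (g i) * \<xi> ^ i\<bar> \<le> B * Y m ^ (M + L * d) / Y m ^ h)"
proof -
  obtain lC lD where l: "lC \<noteq> 0" "lD \<noteq> 0" "num \<longlonglongrightarrow> lC" "den \<longlonglongrightarrow> lD" "\<xi> = lC / lD"
    by (rule num_den_tendsto)
  let ?T = "\<lambda>m. Y m ^ (M + L * d)"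
  define s where "s m i = ev (P i) (X m) * num m ^ (L - i) * den m ^ i" for m i
  define S where "S m = (\<Sum>i\<le>L. ev (P i) (X m) * \<Phi> m ^ i)" for m
  have "\<exists>B. \<forall>m. \<bar>s m i\<bar> \<le> B" for i
  proof -
    have "(\<lambda>m. s m i) \<longlonglongrightarrow> ev (P i) 0 * lC ^ (L - i) * lD ^ i"
      unfolding s_def by (intro tendsto_intros l tendsto_ev X_tendsto)
    then show ?thesis by (rule tendsto_imp_bounded)
  qed
  then obtain Bs where Bs: "\<And>i m. \<bar>s m i\<bar> \<le> Bs i" by metis
  define l0 where "l0 = \<bar>lC ^ L * of_int (fps_nth E h)\<bar>"
  have l0: "l0 > 0" using l \<open>E \<noteq> 0\<close> by (simp add: l0_def h)
  \<comment> \<open>A single constant for the coefficients and for the value of the form, which is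
    eventually below twice its limiting size \<open>l0\<close>.\<close>
  define B where "B = Max (Bs ` {..L}) + 2 * l0"
  have Bs_le: "\<bar>s m i\<bar> \<le> B" if "i \<le> L" for m i
  proof -
    have "Bs i \<le> Max (Bs ` {..L})" using that by (intro Max_ge) auto
    then show ?thesis using Bs[of m i] l0 unfolding B_def by linarith
  qed
  have "0 \<le> Max (Bs ` {..L})"
    using order_trans[OF abs_ge_zero Bs[of 0 0]] by (rule order_trans) (intro Max_ge, auto)
  then have B2: "2 * l0 \<le> B" by (simp add: B_def)
  have "(\<lambda>m. S m / X m ^ h) \<longlonglongrightarrow> of_int (fps_nth E h)"
    using evaluate_relation[where h = h and L = L and P = P] nth_less_subdegree_zero[of _ E]
    unfolding E_def[symmetric] h S_def by blast
  then have lim: "(\<lambda>m. \<bar>num m ^ L * (S m / X m ^ h)\<bar>) \<longlonglongrightarrow> l0"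
    unfolding l0_def by (intro tendsto_intros l)
  have ev: "\<forall>\<^sub>F m in sequentially. l0 / 2 < \<bar>num m ^ L * (S m / X m ^ h)\<bar>"
    using order_tendstoD(1)[OF lim, of "l0 / 2"] l0 by simp
  have ev': "\<forall>\<^sub>F m in sequentially. \<bar>num m ^ L * (S m / X m ^ h)\<bar> < 2 * l0"
    using order_tendstoD(2)[OF lim, of "2 * l0"] l0 by simp
  have "\<forall>\<^sub>F m in sequentially. \<exists>g :: nat \<Rightarrow> int.
    (\<forall>i\<le>L. \<bar>of_int (g i)\<bar> \<le> B * ?T m) \<and>
    (l0 / 2) * ?T m / Y m ^ h \<le> \<bar>\<Sum>i\<le>L. of_int (g i) * \<xi> ^ i\<bar> \<and>
    \<bar>\<Sum>i\<le>L. of_int (g i) * \<xi> ^ i\<bar> \<le> B * ?T m / Y m ^ h"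
    using ev ev'
  proof eventually_elim
    case (elim m)
    have "?T m * s m i \<in> \<int>" if "i \<le> L" for i
    proof -
      have "M + L * d = M + (d * (L - i) + d * i)"
        using that by (simp add: diff_mult_distrib2 mult.commute)
      then have "?T m * s m i = (Y m ^ M * ev (P i) (X m)) * (Y m ^ d * num m) ^ (L - i) * (Y m ^ d * den m) ^ i"
        by (simp add: s_def power_add power_mult power_mult_distrib mult_ac)
      also have "\<dots> \<in> \<int>"
        unfolding num_def den_def
        using assms(2,3) degP[OF that] by (intro Ints_mult Ints_power Ints_ev Ints_prod_ev)
      finally show ?thesis .
    qed
    then have "\<forall>i. \<exists>g. i \<le> L \<longrightarrow> of_int g = ?T m * s m i" by (metis Ints_cases)
    then obtain g :: "nat \<Rightarrow> int" where g: "\<And>i. i \<le> L \<Longrightarrow> of_int (g i) = ?T m * s m i" by metis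
    have T: "?T m > 0" using Y_pos by simp
    have "(\<Sum>i\<le>L. of_int (g i) * \<xi> ^ i) = ?T m * (num m ^ L * S m)"
      unfolding S_def sum_distrib_left
    proof (intro sum.cong refl)
      fix i assume "i \<in> {..L}"
      then have "num m ^ L = num m ^ (L - i) * num m ^ i" by (simp flip: power_add)
      then show "of_int (g i) * \<xi> ^ i = ?T m * (num m ^ L * (ev (P i) (X m) * \<Phi> m ^ i))"
        using \<open>i \<in> {..L}\<close> num_den_neq_0[of m]
        by (simp add: g s_def \<Phi>_def power_mult_distrib power_divide)
    qed
    also have "\<dots> = (num m ^ L * (S m / X m ^ h)) * (?T m / Y m ^ h)"
      using Y_pos[of m] by (simp add: X_def power_divide)
    finally have eq: "\<bar>\<Sum>i\<le>L. of_int (g i) * \<xi> ^ i\<bar> = \<bar>num m ^ L * (S m / X m ^ h)\<bar> * (?T m / Y m ^ h)"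
      using Y_pos[of m] by (simp add: abs_mult)
    have q: "0 \<le> ?T m / Y m ^ h" using Y_pos[of m] by (simp add: less_imp_le)
    have "(l0 / 2) * (?T m / Y m ^ h) \<le> \<bar>\<Sum>i\<le>L. of_int (g i) * \<xi> ^ i\<bar>"
      unfolding eq using elim q by (intro mult_right_mono) auto
    moreover have "\<bar>\<Sum>i\<le>L. of_int (g i) * \<xi> ^ i\<bar> \<le> B * (?T m / Y m ^ h)"
      unfolding eq using elim q B2 by (intro mult_right_mono) auto
    moreover have "\<bar>of_int (g i)\<bar> \<le> B * ?T m" if "i \<le> L" for i
      using Bs_le[OF that, of m] T by (simp add: g[OF that] abs_mult)
    ultimately show ?case by (intro exI[of _ g]) simp
  qed
  then show ?thesis using l0 by (intro exI[of _ "l0 / 2"] exI[of _ B]) simp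
qed

end


section \<open>Passage to complex coefficients\<close>

definition complex_fps :: "int fps \<Rightarrow> complex fps" where
  "complex_fps F = Abs_fps (\<lambda>n. of_int (F $ n))"

lemma complex_fps_nth [simp]: "fps_nth (complex_fps F) n = of_int (F $ n)"
  by (simp add: complex_fps_def)

lemma complex_fps_mult: "complex_fps (F * G) = complex_fps F * complex_fps G"
  by (rule fps_ext) (simp add: fps_mult_nth)

lemma complex_fps_diff: "complex_fps (F - G) = complex_fps F - complex_fps G"
  by (rule fps_ext) simp

lemma complex_fps_1: "complex_fps 1 = 1"
  by (rule fps_ext) simp

lemma complex_fps_power: "complex_fps (F ^ n) = complex_fps F ^ n"
  by (induction n) (simp_all add: complex_fps_mult complex_fps_1)

lemma complex_fps_sum: "complex_fps (\<Sum>i\<in>A. F i) = (\<Sum>i\<in>A. complex_fps (F i))"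
  by (rule fps_ext) (simp add: fps_sum_nth)

lemma complex_fps_of_poly: "complex_fps (fps_of_poly P) = fps_of_poly (map_poly of_int P)"
  by (rule fps_ext) (simp add: coeff_map_poly)

lemma complex_fps_subst_cube: "complex_fps (subst_cube F) = subst_cube (complex_fps F)"
  by (rule fps_ext) (auto simp: fps_compose_nth simp flip: power_mult intro!: sum.cong)

lemma complex_fps_eq_0_iff: "complex_fps F = 0 \<longleftrightarrow> F = 0"
  by (simp add: fps_eq_iff)

lemma map_poly_of_int_neq_0: "P \<noteq> 0 \<Longrightarrow> map_poly (of_int :: int \<Rightarrow> complex) P \<noteq> 0"
  by (simp add: poly_eq_iff coeff_map_poly)

context
  fixes C D :: "int poly"
  assumes C0: "poly C 0 = 1" and D0: "poly D 0 = 1"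
    and irrational: "\<not> rational_fps (reduce_mod3 (mahler_fps C D))"
begin

text \<open>If \<open>f = U / V\<close>, take a Pade remainder \<open>E\<close> with
  \<open>k\<close> at least the degrees of \<open>U\<close> and \<open>V\<close>. Then
  \<open>V E\<close> is a polynomial of degree at most \<open>2 * k\<close> vanishing to order above
  \<open>2 * k\<close>, so it is 0, although \<open>E\<close> is not.\<close>

lemma mahler_fps_not_rational_complex:
  fixes U V :: "complex poly"
  assumes "V \<noteq> 0"
  shows "fps_of_poly V * complex_fps (mahler_fps C D) \<noteq> fps_of_poly U"
proof
  assume eq: "fps_of_poly V * complex_fps (mahler_fps C D) = fps_of_poly U"
  define k where "k = max (degree U) (degree V)"
  obtain P Q where PQ: "degree P \<le> k" "degree Q \<le> k"
    "fps_of_poly Q * mahler_fps C D - fps_of_poly P \<noteq> 0"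
    "2 * k + 1 \<le> subdegree (fps_of_poly Q * mahler_fps C D - fps_of_poly P)"
    by (rule Pade_approximants[OF C0 D0 irrational max.cobounded1 max.cobounded2])
  define E where "E = fps_of_poly Q * mahler_fps C D - fps_of_poly P"
  let ?P = "map_poly of_int P :: complex poly" and ?Q = "map_poly of_int Q :: complex poly"
  have degmap: "degree (map_poly of_int R :: complex poly) \<le> degree R" for R :: "int poly"
    by (rule degree_le) (simp add: coeff_map_poly coeff_eq_0)
  have "degree (U * ?Q) \<le> 2 * k" "degree (V * ?P) \<le> 2 * k"
    using degree_mult_le[of U ?Q] degree_mult_le[of V ?P] PQ(1,2)
      degmap[of P] degmap[of Q]
    unfolding k_def by linarith+
  then have deg: "degree (U * ?Q - V * ?P) \<le> 2 * k" by (rule degree_diff_le)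
  have "fps_of_poly V * complex_fps E = fps_of_poly ?Q * (fps_of_poly V * complex_fps (mahler_fps C D))
      - fps_of_poly V * fps_of_poly ?P"
    by (simp add: E_def complex_fps_diff complex_fps_mult complex_fps_of_poly algebra_simps)
  also have "\<dots> = fps_of_poly (U * ?Q - V * ?P)"
    unfolding eq by (simp add: fps_of_poly_diff fps_of_poly_mult mult.commute)
  finally have VE: "fps_of_poly V * complex_fps E = fps_of_poly (U * ?Q - V * ?P)" .
  have "fps_of_poly V * complex_fps E = 0"
  proof (rule fps_ext)
    fix j
    show "fps_nth (fps_of_poly V * complex_fps E) j = fps_nth 0 j"
    proof (cases "j \<le> 2 * k")
      case True
      have "E $ i = 0" if "i \<le> j" for i
        using that True PQ(4) unfolding E_def by (intro nth_less_subdegree_zero) linarith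
      then show ?thesis by (simp add: fps_mult_nth)
    next
      case False
      then show ?thesis unfolding VE using deg by (simp add: coeff_eq_0 del: coeff_diff)
    qed
  qed
  then show False using assms PQ(3) by (simp add: complex_fps_eq_0_iff E_def)
qed

lemma mahler_fps_transcendental:
  fixes P :: "nat \<Rightarrow> int poly"
  assumes "i \<le> L" "P i \<noteq> 0"
  shows "(\<Sum>i\<le>L. fps_of_poly (P i) * mahler_fps C D ^ i) \<noteq> 0"
proof
  assume "(\<Sum>i\<le>L. fps_of_poly (P i) * mahler_fps C D ^ i) = 0"
  then have rel: "(\<Sum>i\<le>L. fps_of_poly (map_poly of_int (P i)) * complex_fps (mahler_fps C D) ^ i) = 0"
    by (simp flip: complex_fps_of_poly complex_fps_power complex_fps_mult complex_fps_sum
        add: complex_fps_eq_0_iff)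
  have "fps_of_poly (map_poly of_int D) * complex_fps (mahler_fps C D) =
      fps_of_poly (map_poly of_int C) * subst_cube (complex_fps (mahler_fps C D))"
    using mahler_functional_equation[OF C0 D0]
    by (simp flip: complex_fps_of_poly complex_fps_mult complex_fps_subst_cube)
  moreover have "map_poly (of_int :: int \<Rightarrow> complex) C \<noteq> 0" "map_poly (of_int :: int \<Rightarrow> complex) D \<noteq> 0"
    using C0 D0 by (auto intro!: map_poly_of_int_neq_0)
  moreover have "complex_fps (mahler_fps C D) \<noteq> 0"
    using mahler_fps_nth_0[OF C0 D0] by (auto simp: complex_fps_eq_0_iff)
  moreover have "map_poly of_int (P i) \<noteq> (0 :: complex poly)"
    using assms(2) by (rule map_poly_of_int_neq_0)
  ultimately show False
    using rational_of_algebraic[OF _ _ _ _ assms(1) _ rel] mahler_fps_not_rational_complex by blast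
qed

end

subsection \<open>Liouville's inequality\<close>

lemma abs_det_le:
  fixes A :: "int mat"
  assumes A: "A \<in> carrier_mat n n" and "\<And>i j. i < n \<Longrightarrow> j < n \<Longrightarrow> \<bar>A $$ (i, j)\<bar> \<le> T"
  shows "\<bar>det A\<bar> \<le> fact n * T ^ n"
proof -
  have "\<bar>det A\<bar> \<le> (\<Sum>p | p permutes {0..<n}. \<bar>signof p * (\<Prod>i = 0..<n. A $$ (i, p i))\<bar>)"
    unfolding det_def'[OF A] by (rule sum_abs)
  also have "\<dots> \<le> (\<Sum>p | p permutes {0..<n}. T ^ n)"
  proof (rule sum_mono)
    fix p assume "p \<in> {p. p permutes {0..<n}}"
    then have p: "p i < n" if "i < n" for i using that permutes_in_image[of p "{0..<n}" i] by auto
    have "\<bar>signof p * (\<Prod>i = 0..<n. A $$ (i, p i))\<bar> = (\<Prod>i = 0..<n. \<bar>A $$ (i, p i)\<bar>)"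
      by (simp add: abs_mult abs_prod sign_def)
    also have "\<dots> \<le> (\<Prod>i = 0..<n. T)"
      using assms(2) p by (intro prod_mono) auto
    finally show "\<bar>signof p * (\<Prod>i = 0..<n. A $$ (i, p i))\<bar> \<le> T ^ n" by simp
  qed
  also have "\<dots> = fact n * T ^ n" by (simp add: card_permutations)
  finally show ?thesis .
qed

lemma abs_cofactor_le:
  fixes A :: "int mat"
  assumes A: "A \<in> carrier_mat n n" and T: "\<And>i j. i < n \<Longrightarrow> j < n \<Longrightarrow> \<bar>A $$ (i, j)\<bar> \<le> T"
    and "T \<ge> 1" "k < n" "l < n"
  shows "\<bar>cofactor A k l\<bar> \<le> fact n * T ^ n"
proof -
  have "\<bar>cofactor A k l\<bar> = \<bar>det (mat_delete A k l)\<bar>"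
    by (simp add: cofactor_def abs_mult power_abs)
  also have "\<dots> \<le> fact (n - 1) * T ^ (n - 1)"
  proof (rule abs_det_le)
    show "mat_delete A k l \<in> carrier_mat (n - 1) (n - 1)" using A by (rule mat_delete_carrier)
    fix i j assume "i < n - 1" "j < n - 1"
    then show "\<bar>mat_delete A k l $$ (i, j)\<bar> \<le> T"
      using A assms(4,5) by (auto simp: mat_delete_def intro!: T)
  qed
  also have "\<dots> \<le> fact n * T ^ n"
    using \<open>T \<ge> 1\<close> by (intro mult_mono fact_mono power_increasing) auto
  finally show ?thesis .
qed

text \<open>\<open>A\<close> is the matrix of multiplication by \<open>\<mu>\<close> in the basis \<open>1, \<xi>, \<dots>, \<xi> ^ (n - 1)\<close>;
  the first row of \<open>adj A * A = det A\<close>, applied to the basis, bounds \<open>\<mu>\<close> from below.\<close>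
lemma eigenvalue_lower_bound:
  fixes A :: "nat \<Rightarrow> nat \<Rightarrow> int" and \<xi> \<mu> :: real
  assumes eigen: "\<And>i. i < n \<Longrightarrow> (\<Sum>j<n. of_int (A i j) * \<xi> ^ j) = \<mu> * \<xi> ^ i"
    and indep: "\<And>w :: nat \<Rightarrow> int. (\<Sum>i<n. of_int (w i) * \<xi> ^ i) = 0 \<Longrightarrow> (\<forall>i<n. w i = 0)"
    and T: "\<And>i j. i < n \<Longrightarrow> j < n \<Longrightarrow> \<bar>A i j\<bar> \<le> T" "T \<ge> 1" and "\<mu> \<noteq> 0" and "n > 0"
  shows "1 \<le> \<bar>\<mu>\<bar> * (fact n * of_int T ^ n * (\<Sum>k<n. \<bar>\<xi>\<bar> ^ k))"
proof -
  define B where "B = mat n n (\<lambda>(i, j). A i j)"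
  have B: "B \<in> carrier_mat n n" by (simp add: B_def)
  \<comment> \<open>An integer vector \<open>w\<close> annihilating the rows gives
    \<open>\<mu>\<close> times a combination of \<open>1, \<xi>, ..., \<xi> ^ (n - 1)\<close> equal
    to 0, contrary to independence.\<close>
  have "det B \<noteq> 0"
  proof
    assume "det B = 0"
    then have "det (transpose_mat B) = 0" using det_transpose[OF B] by simp
    moreover have Bt: "transpose_mat B \<in> carrier_mat n n" using B by simp
    ultimately obtain w where w: "w \<in> carrier_vec n" "w \<noteq> 0\<^sub>v n" "transpose_mat B *\<^sub>v w = 0\<^sub>v n"
      using det_0_iff_vec_prod_zero[OF Bt] by blast
    have wA: "(\<Sum>i<n. vec_index w i * A i j) = 0" if "j < n" for j
    proof -
      have "vec_index (transpose_mat B *\<^sub>v w) j = col B j \<bullet> w" using B that by simp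
      also have "\<dots> = (\<Sum>i = 0..<n. A i j * vec_index w i)"
        using w(1) that by (simp add: scalar_prod_def B_def)
      finally show ?thesis using w(3) that by (simp add: atLeast0LessThan mult.commute)
    qed
    have "\<mu> * (\<Sum>i<n. of_int (vec_index w i) * \<xi> ^ i) = (\<Sum>i<n. of_int (vec_index w i) * (\<Sum>j<n. of_int (A i j) * \<xi> ^ j))"
      unfolding sum_distrib_left by (intro sum.cong) (auto simp: eigen sum_distrib_left[symmetric])
    also have "\<dots> = (\<Sum>j<n. \<Sum>i<n. of_int (vec_index w i) * (of_int (A i j) * \<xi> ^ j))"
      unfolding sum_distrib_left by (rule sum.swap)
    also have "\<dots> = (\<Sum>j<n. of_int (\<Sum>i<n. vec_index w i * A i j) * \<xi> ^ j)"
      by (simp add: sum_distrib_right mult.assoc)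
    also have "\<dots> = 0" using wA by simp
    finally have "(\<Sum>i<n. of_int (vec_index w i) * \<xi> ^ i) = 0" using \<open>\<mu> \<noteq> 0\<close> by simp
    then have "\<forall>i<n. vec_index w i = 0" by (rule indep)
    then have "w = 0\<^sub>v n" using w(1) by (intro eq_vecI) auto
    then show False using w(2) by simp
  qed
  define a where "a k = cofactor B k 0" for k
  have adj: "(\<Sum>k<n. a k * A k j) = (if j = 0 then det B else 0)" if "j < n" for j
  proof -
    have "(adj_mat B * B) $$ (0, j) = (\<Sum>k = 0..<n. a k * A k j)"
      using B that \<open>n > 0\<close> by (simp add: adj_mat_def scalar_prod_def a_def B_def)
    moreover have "(adj_mat B * B) $$ (0, j) = (if j = 0 then det B else 0)"
      unfolding adj_mat(3)[OF B] using that \<open>n > 0\<close> by simp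
    ultimately show ?thesis by (simp only: atLeast0LessThan)
  qed
  have "\<mu> * (\<Sum>k<n. of_int (a k) * \<xi> ^ k) = (\<Sum>k<n. of_int (a k) * (\<Sum>j<n. of_int (A k j) * \<xi> ^ j))"
    unfolding sum_distrib_left by (intro sum.cong) (auto simp: eigen sum_distrib_left[symmetric])
  also have "\<dots> = (\<Sum>j<n. \<Sum>k<n. of_int (a k) * (of_int (A k j) * \<xi> ^ j))"
    unfolding sum_distrib_left by (rule sum.swap)
  also have "\<dots> = (\<Sum>j<n. of_int (\<Sum>k<n. a k * A k j) * \<xi> ^ j)"
    by (simp add: sum_distrib_right mult.assoc)
  also have "\<dots> = (\<Sum>j<n. if j = 0 then of_int (det B) else 0)"
    using adj by (intro sum.cong) auto
  also have "\<dots> = of_int (det B)" using \<open>n > 0\<close> by simp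
  finally have det: "of_int (det B) = \<mu> * (\<Sum>k<n. of_int (a k) * \<xi> ^ k)" by simp
  have "1 \<le> \<bar>det B\<bar>" using \<open>det B \<noteq> 0\<close> by linarith
  then have "1 \<le> \<bar>of_int (det B) :: real\<bar>" by (metis of_int_1_le_iff of_int_abs)
  also have "\<dots> = \<bar>\<mu>\<bar> * \<bar>\<Sum>k<n. of_int (a k) * \<xi> ^ k\<bar>" by (simp add: det abs_mult)
  also have "\<dots> \<le> \<bar>\<mu>\<bar> * (fact n * of_int T ^ n * (\<Sum>k<n. \<bar>\<xi>\<bar> ^ k))"
  proof (rule mult_left_mono)
    have "\<bar>\<Sum>k<n. of_int (a k) * \<xi> ^ k\<bar> \<le> (\<Sum>k<n. \<bar>of_int (a k) * \<xi> ^ k\<bar>)" by (rule sum_abs)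
    also have "\<dots> \<le> (\<Sum>k<n. (fact n * of_int T ^ n) * \<bar>\<xi>\<bar> ^ k)"
    proof (rule sum_mono)
      fix k assume "k \<in> {..<n}"
      then have "\<bar>a k\<bar> \<le> fact n * T ^ n"
        unfolding a_def using T \<open>n > 0\<close> by (intro abs_cofactor_le[OF B]) (auto simp: B_def)
      then have "of_int \<bar>a k\<bar> \<le> (of_int (fact n * T ^ n) :: real)" by (simp only: of_int_le_iff)
      then have "\<bar>of_int (a k)\<bar> \<le> (fact n * of_int T ^ n :: real)" by simp
      then show "\<bar>of_int (a k) * \<xi> ^ k\<bar> \<le> (fact n * of_int T ^ n) * \<bar>\<xi>\<bar> ^ k"
        by (simp add: abs_mult power_abs mult_right_mono)
    qed
    finally show "\<bar>\<Sum>k<n. of_int (a k) * \<xi> ^ k\<bar> \<le> fact n * of_int T ^ n * (\<Sum>k<n. \<bar>\<xi>\<bar> ^ k)"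
      by (simp only: sum_distrib_left)
  qed simp
  finally show ?thesis .
qed

text \<open>Multiplication by the value \<open>G\<close> of a form, scaled by a power of the leading
  coefficient \<open>a\<close> of a least-degree integer polynomial killing \<open>\<xi>\<close>,
  has an integer matrix with entries \<open>O(H)\<close>; the eigenvalue bound then applies. The
  exponent \<open>n\<close> is fixed before \<open>L\<close>, so that \<open>L\<close> may later be
  chosen in terms of \<open>n\<close>.\<close>

lemma Liouville_inequality:
  fixes \<xi> :: real
  assumes "algebraic \<xi>"
  obtains n where "\<And>L. \<exists>c>0. \<forall>(g :: nat \<Rightarrow> int) H. H \<ge> 1 \<longrightarrow> (\<forall>i\<le>L. \<bar>of_int (g i)\<bar> \<le> H) \<longrightarrow>
    (\<Sum>i\<le>L. of_int (g i) * \<xi> ^ i) \<noteq> 0 \<longrightarrow> c \<le> \<bar>\<Sum>i\<le>L. of_int (g i) * \<xi> ^ i\<bar> * H ^ n"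
proof -
  obtain p0 :: "int poly" where p0: "p0 \<noteq> 0" "ev p0 \<xi> = 0"
    using algebraicE'[OF assms] unfolding ev_def by blast
  define n where "n = (LEAST n. \<exists>p. p \<noteq> 0 \<and> ev p \<xi> = 0 \<and> degree p = n)"
  have ex: "\<exists>n p. p \<noteq> 0 \<and> ev p \<xi> = 0 \<and> degree p = n" using p0 by blast
  obtain p where p: "p \<noteq> 0" "ev p \<xi> = 0" "degree p = n"
    using LeastI_ex[OF ex] unfolding n_def by blast
  have minimal: "q = 0" if "ev q \<xi> = 0" "degree q < n" for q
    using that not_less_Least[of "degree q" "\<lambda>n. \<exists>p. p \<noteq> 0 \<and> ev p \<xi> = 0 \<and> degree p = n"]
    unfolding n_def by blast
  have n0: "n > 0"
  proof (rule ccontr)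
    assume "\<not> n > 0"
    then have "degree p = 0" using p by simp
    then obtain a where "p = [:a:]" by (rule degree_eq_zeroE)
    then show False using p by (simp add: ev_pCons)
  qed
  define a where "a = lead_coeff p"
  have a: "a \<noteq> 0" using p(1) by (simp add: a_def)
  have indep: "\<forall>i<n. w i = 0" if "(\<Sum>i<n. of_int (w i) * \<xi> ^ i) = 0" for w :: "nat \<Rightarrow> int"
  proof -
    define q where "q = (\<Sum>i<n. monom (w i) i)"
    have cq: "coeff q i = (if i < n then w i else 0)" for i by (simp add: q_def coeff_sum coeff_monom)
    have "ev q \<xi> = 0" using that by (simp add: q_def ev_sum ev_monom)
    moreover have "degree q \<le> n - 1" by (rule degree_le) (use n0 in \<open>auto simp: cq\<close>)
    then have "degree q < n" using n0 by simp
    ultimately have "q = 0" by (rule minimal)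
    then show ?thesis using cq by (metis coeff_0)
  qed
  have top: "of_int a * \<xi> ^ n = - (\<Sum>j<n. of_int (coeff p j) * \<xi> ^ j)"
    using p ev_altdef[of p n \<xi>] by (simp add: a_def lessThan_Suc_atMost[symmetric])
  have "\<exists>r :: nat \<Rightarrow> int. of_int a ^ k * \<xi> ^ k = (\<Sum>j<n. of_int (r j) * \<xi> ^ j)" for k
  proof (induction k)
    case 0
    have "(\<Sum>j<n. of_int (if j = 0 then 1 else 0) * \<xi> ^ j) = (\<Sum>j<n. if j = 0 then 1 else 0)"
      by (intro sum.cong) auto
    then show ?case using n0 by (intro exI[of _ "\<lambda>j. if j = 0 then 1 else 0"]) simp
  next
    case (Suc k)
    then obtain r :: "nat \<Rightarrow> int" where r: "of_int a ^ k * \<xi> ^ k = (\<Sum>j<n. of_int (r j) * \<xi> ^ j)" by blast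
    obtain n' where n': "n = Suc n'" using n0 by (cases n) auto
    \<comment> \<open>Multiplication by \<open>a * \<xi>\<close> shifts the coefficients, and the
      overflow \<open>a * \<xi> ^ n\<close> is rewritten by the polynomial equation
      \<open>top\<close>.\<close>
    define r' where "r' j = (if j = 0 then 0 else a * r (j - 1)) - r n' * coeff p j" for j
    have "of_int a ^ Suc k * \<xi> ^ Suc k = of_int a * \<xi> * (\<Sum>j<n. of_int (r j) * \<xi> ^ j)"
      by (simp add: r[symmetric] mult_ac)
    also have "\<dots> = (\<Sum>j<n'. of_int (a * r j) * \<xi> ^ Suc j) + of_int (r n') * (of_int a * \<xi> ^ n)"
      by (simp add: n' sum_distrib_left algebra_simps)
    also have "(\<Sum>j<n'. of_int (a * r j) * \<xi> ^ Suc j) = (\<Sum>j<n. of_int (if j = 0 then 0 else a * r (j - 1)) * \<xi> ^ j)"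
      unfolding n' by (subst sum.lessThan_Suc_shift) simp
    also have "\<dots> + of_int (r n') * (of_int a * \<xi> ^ n) = (\<Sum>j<n. of_int (r' j) * \<xi> ^ j)"
      unfolding top by (simp add: r'_def algebra_simps sum_distrib_left sum_subtractf)
    finally show ?case by blast
  qed
  then obtain r :: "nat \<Rightarrow> nat \<Rightarrow> int" where
    r: "\<And>k. of_int a ^ k * \<xi> ^ k = (\<Sum>j<n. of_int (r k j) * \<xi> ^ j)" by metis
  show thesis
  proof (rule that[of n])
    fix L
    \<comment> \<open>\<open>a ^ K\<close> clears the denominators of all powers
      \<open>\<xi> ^ (l + i)\<close> with \<open>l \<le> L\<close> and \<open>i < n\<close>.\<close>
    define K where "K = L + n"
    define R where "R = (\<Sum>l\<le>L. \<Sum>i<n. \<Sum>j<n. \<bar>a ^ (K - l - i) * r (l + i) j\<bar>) + 1"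
    have R1: "R \<ge> 1" unfolding R_def by (simp add: sum_nonneg)
    \<comment> \<open>The factor 2 pays for rounding the real bound:
      \<open>\<lceil>H\<rceil> \<le> 2 * H\<close> for \<open>H \<ge> 1\<close>.\<close>
    define Z where "Z = \<bar>of_int a\<bar> ^ K * (fact n * (2 * of_int R) ^ n * (\<Sum>k<n. \<bar>\<xi>\<bar> ^ k))"
    have "1 \<le> (\<Sum>k<n. \<bar>\<xi>\<bar> ^ k)"
      using member_le_sum[of 0 "{..<n}" "\<lambda>k. \<bar>\<xi>\<bar> ^ k"] n0 by simp
    then have Z: "Z > 0" using a R1 unfolding Z_def by (intro mult_pos_pos) auto
    have "1 / Z \<le> \<bar>\<Sum>i\<le>L. of_int (g i) * \<xi> ^ i\<bar> * H ^ n"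
      if H: "H \<ge> 1" "\<forall>i\<le>L. \<bar>of_int (g i)\<bar> \<le> H" and nz: "(\<Sum>i\<le>L. of_int (g i) * \<xi> ^ i) \<noteq> 0"
      for g :: "nat \<Rightarrow> int" and H :: real
    proof -
      define G where "G = (\<Sum>i\<le>L. of_int (g i) * \<xi> ^ i)"
      define A where "A i j = (\<Sum>l\<le>L. g l * (a ^ (K - l - i) * r (l + i) j))" for i j
      have eigen: "(\<Sum>j<n. of_int (A i j) * \<xi> ^ j) = (of_int a ^ K * G) * \<xi> ^ i" if "i < n" for i
      proof -
        have "(of_int a ^ K * G) * \<xi> ^ i = (\<Sum>l\<le>L. of_int (g l) * (of_int a ^ (K - l - i) * (of_int a ^ (l + i) * \<xi> ^ (l + i))))"
          unfolding G_def sum_distrib_left sum_distrib_right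
        proof (intro sum.cong refl)
          fix l assume "l \<in> {..L}"
          then have "K = (K - l - i) + (l + i)" using that by (simp add: K_def)
          then have "of_int a ^ K = (of_int a ^ (K - l - i) * of_int a ^ (l + i) :: real)"
            by (metis power_add)
          then show "of_int a ^ K * (of_int (g l) * \<xi> ^ l) * \<xi> ^ i =
              of_int (g l) * (of_int a ^ (K - l - i) * (of_int a ^ (l + i) * \<xi> ^ (l + i)))"
            by (simp add: power_add mult_ac)
        qed
        also have "\<dots> = (\<Sum>l\<le>L. \<Sum>j<n. of_int (g l) * (of_int a ^ (K - l - i) * (of_int (r (l + i) j) * \<xi> ^ j)))"
          unfolding r sum_distrib_left ..
        also have "\<dots> = (\<Sum>j<n. of_int (A i j) * \<xi> ^ j)"
          by (subst sum.swap) (simp add: A_def sum_distrib_right mult.assoc)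
        finally show ?thesis by simp
      qed
      have A_le: "\<bar>A i j\<bar> \<le> \<lceil>H\<rceil> * R" if "i < n" "j < n" for i j
      proof -
        have "\<bar>A i j\<bar> \<le> (\<Sum>l\<le>L. \<bar>g l * (a ^ (K - l - i) * r (l + i) j)\<bar>)"
          unfolding A_def by (rule sum_abs)
        also have "\<dots> \<le> (\<Sum>l\<le>L. \<lceil>H\<rceil> * \<bar>a ^ (K - l - i) * r (l + i) j\<bar>)"
        proof (rule sum_mono)
          fix l assume "l \<in> {..L}"
          then have "of_int \<bar>g l\<bar> \<le> H" using H(2) by simp
          then have "\<bar>g l\<bar> \<le> \<lceil>H\<rceil>" by linarith
          then show "\<bar>g l * (a ^ (K - l - i) * r (l + i) j)\<bar> \<le> \<lceil>H\<rceil> * \<bar>a ^ (K - l - i) * r (l + i) j\<bar>"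
            unfolding abs_mult[of "g l"] by (rule mult_right_mono) simp
        qed
        also have "\<dots> = \<lceil>H\<rceil> * (\<Sum>l\<le>L. \<bar>a ^ (K - l - i) * r (l + i) j\<bar>)" by (simp add: sum_distrib_left)
        also have "\<dots> \<le> \<lceil>H\<rceil> * R"
        proof (rule mult_left_mono)
          have "(\<Sum>l\<le>L. \<bar>a ^ (K - l - i) * r (l + i) j\<bar>) \<le> (\<Sum>l\<le>L. \<Sum>i<n. \<Sum>j<n. \<bar>a ^ (K - l - i) * r (l + i) j\<bar>)"
          proof (rule sum_mono)
            fix l
            have "\<bar>a ^ (K - l - i) * r (l + i) j\<bar> \<le> (\<Sum>j<n. \<bar>a ^ (K - l - i) * r (l + i) j\<bar>)"
              using that by (intro member_le_sum[of j]) auto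
            also have "\<dots> \<le> (\<Sum>i<n. \<Sum>j<n. \<bar>a ^ (K - l - i) * r (l + i) j\<bar>)"
              using that by (intro member_le_sum[of i "{..<n}" "\<lambda>i. \<Sum>j<n. \<bar>a ^ (K - l - i) * r (l + i) j\<bar>"])
                (auto intro: sum_nonneg)
            finally show "\<bar>a ^ (K - l - i) * r (l + i) j\<bar> \<le> (\<Sum>i<n. \<Sum>j<n. \<bar>a ^ (K - l - i) * r (l + i) j\<bar>)" .
          qed
          then show "(\<Sum>l\<le>L. \<bar>a ^ (K - l - i) * r (l + i) j\<bar>) \<le> R" by (simp add: R_def)
          show "0 \<le> \<lceil>H\<rceil>" using H by linarith
        qed
        finally show ?thesis .
      qed
      have "\<lceil>H\<rceil> \<ge> 1" using H by linarith
      then have T1: "\<lceil>H\<rceil> * R \<ge> 1" using R1 mult_mono[of 1 "\<lceil>H\<rceil>" 1 R] by simp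
      have "1 \<le> \<bar>of_int a ^ K * G\<bar> * (fact n * of_int (\<lceil>H\<rceil> * R) ^ n * (\<Sum>k<n. \<bar>\<xi>\<bar> ^ k))"
        using eigen indep A_le T1 a nz n0 by (intro eigenvalue_lower_bound[of n A \<xi>]) (auto simp: G_def)
      also have "\<dots> \<le> \<bar>of_int a ^ K * G\<bar> * (fact n * (H * (2 * of_int R)) ^ n * (\<Sum>k<n. \<bar>\<xi>\<bar> ^ k))"
      proof -
        have "of_int \<lceil>H\<rceil> \<le> 2 * H" using H(1) by linarith
        then have "of_int (\<lceil>H\<rceil> * R) \<le> (2 * H) * of_int R"
          unfolding of_int_mult using R1 by (intro mult_right_mono) auto
        moreover have "0 \<le> (of_int (\<lceil>H\<rceil> * R) :: real)"
          unfolding of_int_0_le_iff using T1 by linarith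
        ultimately have "of_int (\<lceil>H\<rceil> * R) ^ n \<le> (H * (2 * of_int R)) ^ n"
          by (intro power_mono) (simp_all add: mult_ac)
        then show ?thesis
          by (intro mult_left_mono mult_right_mono) (auto intro: sum_nonneg)
      qed
      also have "\<dots> = (\<bar>G\<bar> * H ^ n) * Z"
        by (simp add: Z_def abs_mult power_abs power_mult_distrib mult_ac)
      finally show ?thesis using Z by (simp add: G_def pos_divide_le_eq)
    qed
    then show "\<exists>c>0. \<forall>(g :: nat \<Rightarrow> int) H. H \<ge> 1 \<longrightarrow> (\<forall>i\<le>L. \<bar>of_int (g i)\<bar> \<le> H) \<longrightarrow>
      (\<Sum>i\<le>L. of_int (g i) * \<xi> ^ i) \<noteq> 0 \<longrightarrow> c \<le> \<bar>\<Sum>i\<le>L. of_int (g i) * \<xi> ^ i\<bar> * H ^ n"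
      using Z by (intro exI[of _ "1 / Z"]) simp
  qed
qed


subsection \<open>The value at \<open>1/b\<close>\<close>

context mahler_point
begin

lemma Y_ge_1: "Y n \<ge> 1"
  using b by (simp add: Y_def)

lemma filterlim_Y: "filterlim Y at_top sequentially"
proof -
  have "(\<lambda>n. inverse (X n)) = Y" by (simp add: X_def)
  then show ?thesis
    using filterlim_inverse_at_top[OF X_tendsto] X_pos by simp
qed

lemma eventually_less_Y: "\<forall>\<^sub>F m in sequentially. c < Y m"
  using filterlim_Y by (simp add: filterlim_at_top_dense)

text \<open>The forms have coefficients \<open>O(T)\<close> and value \<open>O(T / Y m ^ h)\<close>
  with \<open>T = Y m ^ (M + L * d)\<close>. Liouville would bound
  \<open>T ^ (n + 1) / Y m ^ h\<close> away from 0, while the order \<open>h\<close> exceeds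
  \<open>(n + 1) * (M + L * d)\<close>.\<close>

lemma not_algebraic_xi:
  assumes irr: "\<not> rational_fps (reduce_mod3 f)"
  shows "\<not> algebraic \<xi>"
proof
  assume "algebraic \<xi>"
  then obtain n where Liouville: "\<And>L. \<exists>c>0. \<forall>(g :: nat \<Rightarrow> int) H. H \<ge> 1 \<longrightarrow>
    (\<forall>i\<le>L. \<bar>of_int (g i)\<bar> \<le> H) \<longrightarrow> (\<Sum>i\<le>L. of_int (g i) * \<xi> ^ i) \<noteq> 0 \<longrightarrow>
    c \<le> \<bar>\<Sum>i\<le>L. of_int (g i) * \<xi> ^ i\<bar> * H ^ n"
    by (rule Liouville_inequality) blast
  define d where "d = max (degree C) (degree D)"
  \<comment> \<open>The order is at least about \<open>(L + 1) * M = (n + 2) * M\<close>, one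
    \<open>M\<close> more than the term \<open>(n + 1) * M\<close>; the choice of \<open>M\<close>
    lets this surplus cover \<open>(n + 1) * (L * d) + 1\<close>.\<close>
  define L where "L = n + 1"
  define M where "M = (n + 1) * (L * d) + 1"
  obtain P where P: "\<And>i. i \<le> L \<Longrightarrow> degree (P i) \<le> M" "\<exists>i\<le>L. \<exists>j. \<not> 2 dvd coeff (P i) j"
    "\<And>j. j < (L + 1) * (M + 1) - 1 \<Longrightarrow> (\<Sum>i\<le>L. fps_of_poly (P i) * f ^ i) $ j = 0"
    using Hermite_Pade_approximants[of 2 L M "\<lambda>i. f ^ i"] by auto
  define E where "E = (\<Sum>i\<le>L. fps_of_poly (P i) * f ^ i)"
  define h where "h = subdegree E"
  obtain i j where "i \<le> L" "\<not> 2 dvd coeff (P i) j" using P(2) by blast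
  moreover from this have "P i \<noteq> 0" by auto
  ultimately have E0: "E \<noteq> 0"
    unfolding E_def using mahler_fps_transcendental[OF C0 D0 irr] by blast
  have "(L + 1) * (M + 1) - 1 \<le> h"
    unfolding h_def using E0 P(3) by (intro subdegree_geI) (auto simp: E_def)
  moreover have "(n + 1) * (M + L * d) + 1 \<le> (L + 1) * (M + 1) - 1"
    by (simp add: L_def M_def algebra_simps)
  ultimately have h: "(n + 1) * (M + L * d) + 1 \<le> h" by linarith
  obtain c B where c: "c > 0" and forms: "\<forall>\<^sub>F m in sequentially. \<exists>g :: nat \<Rightarrow> int.
    (\<forall>i\<le>L. \<bar>of_int (g i)\<bar> \<le> B * Y m ^ (M + L * d)) \<and>
    c * Y m ^ (M + L * d) / Y m ^ h \<le> \<bar>\<Sum>i\<le>L. of_int (g i) * \<xi> ^ i\<bar> \<and>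
    \<bar>\<Sum>i\<le>L. of_int (g i) * \<xi> ^ i\<bar> \<le> B * Y m ^ (M + L * d) / Y m ^ h"
    using integer_forms[of d L P M h] P(1) E0 unfolding E_def h_def d_def by auto
  obtain c' where c': "c' > 0" and lower: "\<And>(g :: nat \<Rightarrow> int) H. H \<ge> 1 \<Longrightarrow>
    (\<forall>i\<le>L. \<bar>of_int (g i)\<bar> \<le> H) \<Longrightarrow> (\<Sum>i\<le>L. of_int (g i) * \<xi> ^ i) \<noteq> 0 \<Longrightarrow>
    c' \<le> \<bar>\<Sum>i\<le>L. of_int (g i) * \<xi> ^ i\<bar> * H ^ n"
    using Liouville[of L] by blast
  define B' where "B' = max B 1"
  have "\<forall>\<^sub>F m in sequentially. B' ^ (n + 1) / c' < Y m" by (rule eventually_less_Y)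
  with forms have "\<forall>\<^sub>F m in sequentially. False"
  proof eventually_elim
    case (elim m)
    define T where "T = Y m ^ (M + L * d)"
    have T1: "T \<ge> 1" unfolding T_def using Y_ge_1 by (rule one_le_power)
    have Yh: "Y m ^ h > 0" using Y_pos by simp
    obtain g :: "nat \<Rightarrow> int" where g: "\<forall>i\<le>L. \<bar>of_int (g i)\<bar> \<le> B * T"
      "c * T / Y m ^ h \<le> \<bar>\<Sum>i\<le>L. of_int (g i) * \<xi> ^ i\<bar>"
      "\<bar>\<Sum>i\<le>L. of_int (g i) * \<xi> ^ i\<bar> \<le> B * T / Y m ^ h"
      using elim(1) unfolding T_def by blast
    have "0 < c * T / Y m ^ h" using c T1 Yh by (intro divide_pos_pos mult_pos_pos) auto
    then have nz: "(\<Sum>i\<le>L. of_int (g i) * \<xi> ^ i) \<noteq> 0" using g(2) by auto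
    have BT: "B * T \<le> B' * T" unfolding B'_def using T1 by (intro mult_right_mono) auto
    have B'T: "B' * T \<ge> 1" using mult_mono[of 1 B' 1 T] T1 by (simp add: B'_def)
    have "c' \<le> \<bar>\<Sum>i\<le>L. of_int (g i) * \<xi> ^ i\<bar> * (B' * T) ^ n"
      using g(1) BT by (intro lower B'T nz) (meson order_trans)
    also have "\<dots> \<le> (B' * T / Y m ^ h) * (B' * T) ^ n"
    proof (rule mult_right_mono)
      have "B * T / Y m ^ h \<le> B' * T / Y m ^ h" using BT Yh by (intro divide_right_mono) auto
      then show "\<bar>\<Sum>i\<le>L. of_int (g i) * \<xi> ^ i\<bar> \<le> B' * T / Y m ^ h" using g(3) by linarith
    qed (use B'T in simp)
    also have "\<dots> = B' ^ (n + 1) * Y m ^ ((n + 1) * (M + L * d)) / Y m ^ h"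
    proof -
      have "T ^ (n + 1) = Y m ^ ((n + 1) * (M + L * d))"
        unfolding T_def power_mult[symmetric] by (simp only: mult.commute)
      moreover have "(B' * T / Y m ^ h) * (B' * T) ^ n = B' ^ (n + 1) * T ^ (n + 1) / Y m ^ h"
        by (simp add: power_mult_distrib)
      ultimately show ?thesis by simp
    qed
    also have "\<dots> \<le> B' ^ (n + 1) / Y m"
    proof -
      have "Y m * Y m ^ ((n + 1) * (M + L * d)) = Y m ^ ((n + 1) * (M + L * d) + 1)" by simp
      also have "\<dots> \<le> Y m ^ h" using h Y_ge_1 by (rule power_increasing)
      finally have "B' ^ (n + 1) * (Y m * Y m ^ ((n + 1) * (M + L * d))) \<le> B' ^ (n + 1) * Y m ^ h"
        by (intro mult_left_mono) (auto simp: B'_def)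
      then show ?thesis using Y_pos[of m] Yh by (simp add: pos_divide_le_eq pos_le_divide_eq mult_ac)
    qed
    finally have "c' \<le> B' ^ (n + 1) / Y m" .
    then have "Y m \<le> B' ^ (n + 1) / c'" using c' Y_pos[of m] by (simp add: field_simps)
    then show False using elim(2) by simp
  qed
  then show False by simp
qed

text \<open>The case \<open>L = 1\<close> with order \<open>h\<close> between
  \<open>2 * k + 1\<close> and \<open>2 * k + d\<close>. The unknown constants are each absorbed by
  one further factor \<open>Y m\<close> for large \<open>m\<close>, which leaves pure powers of
  \<open>Y m\<close>.\<close>

lemma linear_forms:
  assumes irr: "\<not> rational_fps (reduce_mod3 f)" and d: "degree C \<le> d" "degree D \<le> d"
  shows "\<forall>\<^sub>F m in sequentially. \<exists>g0 g1 :: int. 2 * \<bar>of_int g1\<bar> < Y m ^ (k + d + 1) \<and>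
    2 * \<bar>of_int g0 + of_int g1 * \<xi>\<bar> * Y m ^ k < Y m ^ d \<and>
    1 < \<bar>of_int g0 + of_int g1 * \<xi>\<bar> * Y m ^ (k + 1)"
proof -
  obtain P Q where PQ: "degree P \<le> k" "degree Q \<le> k"
    "fps_of_poly Q * f - fps_of_poly P \<noteq> 0"
    "2 * k + 1 \<le> subdegree (fps_of_poly Q * f - fps_of_poly P)"
    "subdegree (fps_of_poly Q * f - fps_of_poly P) \<le> 2 * k + d"
    by (rule Pade_approximants[OF C0 D0 irr d])
  define h where "h = subdegree (fps_of_poly Q * f - fps_of_poly P)"
  define R where "R i = (if i = 0 then - P else Q)" for i :: nat
  have E: "(\<Sum>i\<le>1. fps_of_poly (R i) * f ^ i) = fps_of_poly Q * f - fps_of_poly P"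
    by (simp add: R_def fps_of_poly_uminus)
  have "\<exists>c B. c > 0 \<and> (\<forall>\<^sub>F m in sequentially. \<exists>g :: nat \<Rightarrow> int.
    (\<forall>i\<le>1. \<bar>of_int (g i)\<bar> \<le> B * Y m ^ (k + 1 * d)) \<and>
    c * Y m ^ (k + 1 * d) / Y m ^ h \<le> \<bar>\<Sum>i\<le>1. of_int (g i) * \<xi> ^ i\<bar> \<and>
    \<bar>\<Sum>i\<le>1. of_int (g i) * \<xi> ^ i\<bar> \<le> B * Y m ^ (k + 1 * d) / Y m ^ h)"
  proof (rule integer_forms[where P = R])
    show "degree (R i) \<le> k" for i using PQ by (simp add: R_def)
    show "(\<Sum>i\<le>1. fps_of_poly (R i) * f ^ i) \<noteq> 0" unfolding E by (rule PQ(3))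
    show "h = subdegree (\<Sum>i\<le>1. fps_of_poly (R i) * f ^ i)" unfolding E h_def ..
  qed (fact d)+
  then obtain c B where c: "c > 0" and forms: "\<forall>\<^sub>F m in sequentially. \<exists>g :: nat \<Rightarrow> int.
    (\<forall>i\<le>1. \<bar>of_int (g i)\<bar> \<le> B * Y m ^ (k + d)) \<and>
    c * Y m ^ (k + d) / Y m ^ h \<le> \<bar>\<Sum>i\<le>1. of_int (g i) * \<xi> ^ i\<bar> \<and>
    \<bar>\<Sum>i\<le>1. of_int (g i) * \<xi> ^ i\<bar> \<le> B * Y m ^ (k + d) / Y m ^ h" by auto
  have "\<forall>\<^sub>F m in sequentially. 2 * B < Y m" "\<forall>\<^sub>F m in sequentially. 1 / c < Y m"
    by (rule eventually_less_Y)+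
  with forms show ?thesis
  proof eventually_elim
    case (elim m)
    then obtain g :: "nat \<Rightarrow> int" where g: "\<bar>of_int (g 1)\<bar> \<le> B * Y m ^ (k + d)"
      "c * Y m ^ (k + d) / Y m ^ h \<le> \<bar>of_int (g 0) + of_int (g 1) * \<xi>\<bar>"
      "\<bar>of_int (g 0) + of_int (g 1) * \<xi>\<bar> \<le> B * Y m ^ (k + d) / Y m ^ h" by auto
    let ?G = "\<bar>of_int (g 0) + of_int (g 1) * \<xi>\<bar>"
    have Yp: "Y m ^ j > 0" for j using Y_pos by simp
    have "2 * \<bar>of_int (g 1)\<bar> \<le> 2 * B * Y m ^ (k + d)" using g(1) by simp
    also have "\<dots> < Y m * Y m ^ (k + d)" using elim(2) Yp by (intro mult_strict_right_mono)
    finally have 1: "2 * \<bar>of_int (g 1)\<bar> < Y m ^ (k + d + 1)" by simp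
    have "0 < c * Y m ^ (k + d) / Y m ^ h" using c Yp by simp
    then have "0 < B * Y m ^ (k + d) / Y m ^ h" using g by linarith
    then have "0 < B * (Y m ^ (k + d) / Y m ^ h)" by simp
    then have B: "B > 0" by (rule zero_less_mult_pos2) (use Yp in simp)
    have "2 * ?G * Y m ^ k \<le> 2 * (B * Y m ^ (k + d) / Y m ^ h) * Y m ^ k"
      using g(3) Yp[of k] by (intro mult_right_mono mult_left_mono) auto
    also have "\<dots> = 2 * B * (Y m ^ (2 * k + d) / Y m ^ h)"
    proof -
      have "2 * k + d = (k + d) + k" by simp
      then have "Y m ^ (2 * k + d) = Y m ^ (k + d) * Y m ^ k" by (simp only: power_add)
      then show ?thesis by simp
    qed
    also have "\<dots> \<le> 2 * B * (Y m ^ d / Y m)"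
    proof (rule mult_left_mono)
      have "Y m ^ (2 * k + d) * Y m = Y m ^ d * Y m ^ (2 * k + 1)" by (simp add: power_add mult_ac)
      also have "\<dots> \<le> Y m ^ d * Y m ^ h"
        using PQ(4) Y_ge_1 Yp[of d] unfolding h_def by (intro mult_left_mono power_increasing) auto
      finally show "Y m ^ (2 * k + d) / Y m ^ h \<le> Y m ^ d / Y m"
        using Yp[of h] Y_pos[of m] by (simp add: pos_divide_le_eq pos_le_divide_eq)
    qed (use B in simp)
    also have "\<dots> = (2 * B / Y m) * Y m ^ d" by simp
    also have "\<dots> < 1 * Y m ^ d"
      using elim(2) Y_pos[of m] Yp by (intro mult_strict_right_mono) auto
    finally have 2: "2 * ?G * Y m ^ k < Y m ^ d" by simp
    have "1 < c * Y m" using elim(3) c by (simp add: divide_less_eq mult.commute)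
    also have "\<dots> = c * (Y m ^ (k + d) / Y m ^ (2 * k + d)) * Y m ^ (k + 1)"
    proof -
      have "2 * k + d + 1 = (k + d) + (k + 1)" by simp
      then have "Y m ^ (2 * k + d) * Y m = Y m ^ (k + d) * Y m ^ (k + 1)"
        by (metis power_add power_one_right)
      then show ?thesis using Yp[of "2 * k + d"] by (simp add: eq_divide_eq mult_ac)
    qed
    also have "\<dots> \<le> c * (Y m ^ (k + d) / Y m ^ h) * Y m ^ (k + 1)"
      using c Yp Y_ge_1[of m] PQ(5) unfolding h_def
      by (intro mult_right_mono mult_left_mono divide_left_mono power_increasing mult_pos_pos) (auto intro: less_imp_le)
    also have "\<dots> \<le> ?G * Y m ^ (k + 1)"
      using g(2) Yp[of "k + 1"] by (intro mult_right_mono) auto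
    finally have 3: "1 < ?G * Y m ^ (k + 1)" .
    show ?case using 1 2 3 by blast
  qed
qed

text \<open>Compare \<open>u/q\<close> with a form \<open>g0 + g1 * \<xi>\<close> whose size is
  adapted to \<open>q\<close>. The integer \<open>q * g0 + g1 * u\<close> has absolute value below
  1, so it is 0; then the form is as small as the approximation dictates, which violates its lower
  bound.\<close>

lemma bounded_denominators:
  assumes irr: "\<not> rational_fps (reduce_mod3 f)" and "\<mu> > 2"
  shows "\<exists>V. \<forall>(u::int) (q::int). q > 0 \<longrightarrow> \<bar>\<xi> - of_int u / of_int q\<bar> < of_int q powr (- \<mu>) \<longrightarrow> of_int q < (V::real)"
proof -
  define d where "d = max (degree C) (degree D)"
  have d: "degree C \<le> d" "degree D \<le> d" by (simp_all add: d_def)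
  \<comment> \<open>With \<open>q \<ge> Y m ^ s\<close>, the gain \<open>q powr (\<mu> - 2)\<close>
    outweighs the total loss \<open>Y m ^ (3 * d + 4)\<close> of the comparison.\<close>
  define s where "s = nat \<lceil>real (3 * d + 4) / (\<mu> - 2)\<rceil> + 1"
  have "real (3 * d + 4) / (\<mu> - 2) \<le> real s" unfolding s_def by linarith
  then have s: "real (3 * d + 4) \<le> real s * (\<mu> - 2)" using \<open>\<mu> > 2\<close> by (simp add: divide_le_eq)
  have s0: "s > 0" by (simp add: s_def)
  \<comment> \<open>Only finitely many \<open>k\<close> occur, so one threshold \<open>m0\<close>
    serves them all.\<close>
  have "\<forall>\<^sub>F m in sequentially. \<forall>k\<in>{..4 * s + d}. \<exists>g0 g1 :: int. 2 * \<bar>of_int g1\<bar> < Y m ^ (k + d + 1) \<and>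
    2 * \<bar>of_int g0 + of_int g1 * \<xi>\<bar> * Y m ^ k < Y m ^ d \<and>
    1 < \<bar>of_int g0 + of_int g1 * \<xi>\<bar> * Y m ^ (k + 1)"
    by (intro eventually_ball_finite ballI linear_forms irr d) simp
  then obtain m0 where m0: "\<And>m k. m \<ge> m0 \<Longrightarrow> k \<le> 4 * s + d \<Longrightarrow> \<exists>g0 g1 :: int.
    2 * \<bar>of_int g1\<bar> < Y m ^ (k + d + 1) \<and>
    2 * \<bar>of_int g0 + of_int g1 * \<xi>\<bar> * Y m ^ k < Y m ^ d \<and>
    1 < \<bar>of_int g0 + of_int g1 * \<xi>\<bar> * Y m ^ (k + 1)"
    unfolding eventually_sequentially by (metis atMost_iff)
  have "of_int q < Y m0 ^ s" if q: "q > 0" and approx: "\<bar>\<xi> - of_int u / of_int q\<bar> < of_int q powr (- \<mu>)"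
    for u q :: int
  proof (rule ccontr)
    assume "\<not> of_int q < Y m0 ^ s"
    then have ge: "Y m0 ^ s \<le> of_int q" by simp
    have "\<forall>\<^sub>F m in sequentially. of_int q < Y m" by (rule eventually_less_Y)
    then obtain m1 where m1: "of_int q < Y m1" by (auto simp: eventually_sequentially)
    have "Y m1 \<le> Y m1 ^ s" using s0 Y_ge_1 by (simp add: self_le_power)
    then have ex: "\<exists>m. of_int q < Y m ^ s" using m1 by (intro exI[of _ m1]) linarith
    \<comment> \<open>Locates \<open>q\<close> first between \<open>Y m ^ s\<close> and
      \<open>Y m ^ (3 * s)\<close>, then below between consecutive powers \<open>Y m ^ k'\<close>
      and \<open>Y m ^ (k' + 1)\<close>.\<close>
    define m' where "m' = (LEAST m. of_int q < Y m ^ s)"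
    have m': "of_int q < Y m' ^ s" unfolding m'_def using ex by (rule LeastI_ex)
    have "m0 < m'"
    proof (rule ccontr)
      assume "\<not> m0 < m'"
      then have "Y m' \<le> Y m0" unfolding Y_def using b by (intro power_increasing) auto
      then have "Y m' ^ s \<le> Y m0 ^ s" using Y_pos[of m'] by (intro power_mono) auto
      then show False using m' ge by simp
    qed
    then obtain m where m: "m' = Suc m" "m0 \<le> m" by (cases m') auto
    have lo: "Y m ^ s \<le> of_int q"
      using not_less_Least[of m "\<lambda>m. of_int q < Y m ^ s"] m(1) unfolding m'_def by auto
    have "Y (Suc m) = Y m ^ 3" by (simp add: Y_def mult.commute flip: power_mult)
    then have hi: "of_int q < Y m ^ (3 * s)" using m' m(1) by (simp add: power_mult)
    define t where "t = (LEAST t. of_int q < Y m ^ t)"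
    have t: "of_int q < Y m ^ t" unfolding t_def using hi by (rule LeastI)
    have "t \<le> 3 * s" unfolding t_def using hi by (rule Least_le)
    have "s < t"
    proof (rule ccontr)
      assume "\<not> s < t"
      then have "Y m ^ t \<le> Y m ^ s" using Y_ge_1 by (intro power_increasing) auto
      then show False using t lo by simp
    qed
    then obtain k' where k': "t = Suc k'" "s \<le> k'" by (cases t) auto
    have qlo: "Y m ^ k' \<le> of_int q"
      using not_less_Least[of k' "\<lambda>t. of_int q < Y m ^ t"] k'(1) unfolding t_def by auto
    have qhi: "of_int q < Y m ^ (k' + 1)" using t k'(1) by simp
    have Yp: "Y m ^ j > 0" for j using Y_pos by simp
    have q0: "(of_int q :: real) > 0" using q by simp
    \<comment> \<open>The exponent is the sum of \<open>k + d + 1\<close>, the size of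
      \<open>g1\<close> for \<open>k = k' + d + 1\<close>, and \<open>d + 2\<close>, the margin that
      the final contradiction uses.\<close>
    have close: "\<bar>of_int q * \<xi> - of_int u\<bar> * Y m ^ (k' + 3 * d + 4) < 1"
    proof -
      have "\<bar>of_int q * \<xi> - of_int u\<bar> = of_int q * \<bar>\<xi> - of_int u / of_int q\<bar>"
        using q0 by (simp add: abs_mult_pos' right_diff_distrib)
      also have "\<dots> < of_int q * of_int q powr (- \<mu>)" using approx q0 by (intro mult_strict_left_mono)
      also have "\<dots> = of_int q powr (- (\<mu> - 1))"
        using q0 by (simp add: powr_mult_base[of "of_int q"] )
      finally have 1: "\<bar>of_int q * \<xi> - of_int u\<bar> < of_int q powr (- (\<mu> - 1))" .
      have "real (k' + 3 * d + 4) \<le> real k' + real s * (\<mu> - 2)" using s by simp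
      also have "\<dots> \<le> real k' + real k' * (\<mu> - 2)"
        using k'(2) \<open>\<mu> > 2\<close> by (intro add_left_mono mult_right_mono) auto
      finally have exp: "real (k' + 3 * d + 4) \<le> real k' * (\<mu> - 1)" by (simp add: algebra_simps)
      have "Y m ^ (k' + 3 * d + 4) = Y m powr real (k' + 3 * d + 4)"
        by (rule powr_realpow[OF Y_pos, symmetric])
      also have "\<dots> \<le> Y m powr (real k' * (\<mu> - 1))" using exp Y_ge_1 by (rule powr_mono)
      also have "\<dots> = (Y m ^ k') powr (\<mu> - 1)" using Y_pos by (simp add: powr_powr[symmetric] powr_realpow)
      also have "\<dots> \<le> of_int q powr (\<mu> - 1)"
        using qlo Yp[of k'] \<open>\<mu> > 2\<close> by (intro powr_mono2) auto
      finally have 2: "Y m ^ (k' + 3 * d + 4) \<le> of_int q powr (\<mu> - 1)" .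
      have "\<bar>of_int q * \<xi> - of_int u\<bar> * Y m ^ (k' + 3 * d + 4) < of_int q powr (- (\<mu> - 1)) * Y m ^ (k' + 3 * d + 4)"
        using 1 Yp by (rule mult_strict_right_mono)
      also have "\<dots> \<le> of_int q powr (- (\<mu> - 1)) * of_int q powr (\<mu> - 1)"
        using 2 by (rule mult_left_mono) simp
      also have "\<dots> = 1" using q0 by (simp flip: powr_add)
      finally show ?thesis .
    qed
    \<comment> \<open>The least shift for which \<open>q < Y m ^ (k' + 1)\<close> and the upper
      bound on the form give \<open>q * ?G < 1 / 2\<close>.\<close>
    define k where "k = k' + d + 1"
    have "k \<le> 4 * s + d" using \<open>t \<le> 3 * s\<close> k' s0 by (simp add: k_def)
    then obtain g0 g1 :: int where g: "2 * \<bar>of_int g1\<bar> < Y m ^ (k + d + 1)"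
      "2 * \<bar>of_int g0 + of_int g1 * \<xi>\<bar> * Y m ^ k < Y m ^ d"
      "1 < \<bar>of_int g0 + of_int g1 * \<xi>\<bar> * Y m ^ (k + 1)"
      using m0[OF m(2)] by blast
    let ?G = "\<bar>of_int g0 + of_int g1 * \<xi>\<bar>" and ?e = "\<bar>of_int q * \<xi> - of_int u\<bar>"
    have G0: "?G > 0" using g(3) by (metis abs_zero abs_ge_zero mult_zero_left not_one_less_zero order_le_less)
    have "2 * (of_int q * ?G) * Y m ^ d < 2 * (Y m ^ (k' + 1) * ?G) * Y m ^ d"
      using qhi G0 Yp[of d] by simp
    also have "\<dots> = 2 * ?G * Y m ^ k" by (simp add: k_def power_add mult_ac)
    also have "\<dots> < 1 * Y m ^ d" using g(2) by simp
    finally have small1: "2 * (of_int q * ?G) < 1" using Yp[of d] by (simp only: mult_less_cancel_right_pos)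
    have small2: "2 * (\<bar>of_int g1\<bar> * ?e) * Y m ^ (d + 2) \<le> 1"
    proof -
      have "2 * (\<bar>of_int g1\<bar> * ?e) * Y m ^ (d + 2) = (2 * \<bar>of_int g1\<bar>) * (?e * Y m ^ (d + 2))" by simp
      also have "\<dots> \<le> Y m ^ (k + d + 1) * (?e * Y m ^ (d + 2))"
        using g(1) Yp[of "d + 2"] by (intro mult_right_mono) auto
      also have "\<dots> = ?e * Y m ^ (k' + 3 * d + 4)"
      proof -
        have "k' + 3 * d + 4 = (k + d + 1) + (d + 2)" by (simp add: k_def)
        then show ?thesis by (simp only: power_add mult_ac)
      qed
      finally show ?thesis using close by simp
    qed
    have "2 * (\<bar>of_int g1\<bar> * ?e) * 1 \<le> 2 * (\<bar>of_int g1\<bar> * ?e) * Y m ^ (d + 2)"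
      using one_le_power[OF Y_ge_1, of m "d + 2"] by (intro mult_left_mono) auto
    then have small2': "2 * (\<bar>of_int g1\<bar> * ?e) \<le> 1" using small2 by linarith
    have id: "of_int (q * g0 + g1 * u) = of_int q * (of_int g0 + of_int g1 * \<xi>) - of_int g1 * (of_int q * \<xi> - of_int u)"
      by (simp add: algebra_simps)
    have "\<bar>of_int (q * g0 + g1 * u) :: real\<bar> \<le> of_int q * ?G + \<bar>of_int g1\<bar> * ?e"
      unfolding id using abs_triangle_ineq4[of "of_int q * (of_int g0 + of_int g1 * \<xi>)" "of_int g1 * (of_int q * \<xi> - of_int u)"]
        q0 by (simp add: abs_mult)
    also have "\<dots> < 1" using small1 small2' by linarith
    finally have "q * g0 + g1 * u = 0" by linarith
    then have "of_int q * (of_int g0 + of_int g1 * \<xi>) = of_int g1 * (of_int q * \<xi> - of_int u)"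
      using id by simp
    then have eq: "of_int q * ?G = \<bar>of_int g1\<bar> * ?e"
      using q0 by (metis abs_mult abs_of_pos)
    \<comment> \<open>The vanishing integer identifies \<open>q * ?G\<close> with
      \<open>\<bar>g1\<bar> * ?e\<close>, so the lower bound on the form makes
      \<open>\<bar>g1\<bar> * ?e * Y m ^ (d + 2)\<close> exceed 1, against
      \<open>small2\<close>.\<close>
    have "1 < ?G * Y m ^ (k + 1)" by (rule g(3))
    also have "\<dots> = Y m ^ k' * ?G * Y m ^ (d + 2)" by (simp add: k_def power_add mult_ac power2_eq_square)
    also have "\<dots> \<le> of_int q * ?G * Y m ^ (d + 2)"
      using qlo G0 Yp[of "d + 2"] by (intro mult_right_mono) auto
    also have "\<dots> = \<bar>of_int g1\<bar> * ?e * Y m ^ (d + 2)" by (simp only: eq)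
    finally show False using small2 by linarith
  qed
  then show ?thesis by blast
qed

end

section \<open>From bounded denominators to the irrationality exponent\<close>

lemma finite_rats_bounded_denominator:
  fixes V \<xi> :: real
  assumes "\<And>r. r \<in> S \<Longrightarrow> of_int (snd (quotient_of r)) < V" and "\<And>r. r \<in> S \<Longrightarrow> \<bar>\<xi> - of_rat r\<bar> \<le> 1"
  shows "finite S"
proof -
  define Z where "Z = \<lceil>V * (\<bar>\<xi>\<bar> + 1)\<rceil>"
  have "S \<subseteq> (\<lambda>(p, q). Rat.Fract p q) ` ({-Z..Z} \<times> {0..\<lceil>V\<rceil>})"
  proof
    fix r assume r: "r \<in> S"
    obtain p q where pq: "quotient_of r = (p, q)" by fastforce
    have q: "q > 0" using quotient_of_denom_pos[OF pq] .
    have r_eq: "r = Rat.Fract p q" using quotient_of_div[OF pq] by (simp add: Fract_of_int_quotient)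
    have V: "of_int q < V" using assms(1)[OF r] pq by simp
    have "of_rat r = (of_int p / of_int q :: real)" using q by (simp add: r_eq of_rat_rat)
    then have "\<bar>\<xi> - of_int p / of_int q\<bar> \<le> 1" using assms(2)[OF r] by simp
    then have "\<bar>of_int p / of_int q\<bar> \<le> \<bar>\<xi>\<bar> + 1" by linarith
    then have "\<bar>of_int p\<bar> \<le> (\<bar>\<xi>\<bar> + 1) * of_int q" using q by (simp add: pos_divide_le_eq)
    also have "\<dots> \<le> (\<bar>\<xi>\<bar> + 1) * V" using V by (intro mult_left_mono) auto
    finally have "\<bar>of_int p\<bar> \<le> V * (\<bar>\<xi>\<bar> + 1)" by (simp add: mult.commute)
    then have "\<bar>p\<bar> \<le> Z" unfolding Z_def by linarith
    moreover have "q \<le> \<lceil>V\<rceil>" using V by linarith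
    ultimately show "r \<in> (\<lambda>(p, q). Rat.Fract p q) ` ({-Z..Z} \<times> {0..\<lceil>V\<rceil>})"
      using q r_eq by (intro image_eqI[of _ _ "(p, q)"]) auto
  qed
  then show ?thesis by (rule finite_subset) auto
qed

text \<open>Dirichlet's theorem. The pairs in \<open>approx_set\<close> are coprime with positive
  denominator, so they are the normal forms returned by \<open>quotient_of\<close>, and distinct
  pairs are distinct rationals.\<close>

lemma infinite_quadratic_approximations:
  fixes \<xi> :: real
  assumes "\<xi> \<notin> \<rat>"
  shows "infinite {r. \<bar>\<xi> - of_rat r\<bar> < of_int (snd (quotient_of r)) powr (- 2)}"
proof
  let ?S = "{r. \<bar>\<xi> - of_rat r\<bar> < of_int (snd (quotient_of r)) powr (- 2)}"
  assume fin: "finite ?S"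
  have q: "quotient_of (Rat.Fract h k) = (h, k)" if "k > 0" "coprime h k" for h k
    using that by (simp add: quotient_of_Fract normalize_stable)
  have "approx_set \<xi> \<subseteq> quotient_of ` ?S"
  proof
    fix x assume "x \<in> approx_set \<xi>"
    then obtain h k :: int where x: "x = (h, k)" "k > 0" "coprime h k"
      "\<bar>\<xi> - of_int h / of_int k\<bar> < 1 / (of_int k)\<^sup>2"
      by (auto simp: approx_set_def)
    have "of_rat (Rat.Fract h k) = (of_int h / of_int k :: real)" using x by (simp add: of_rat_rat)
    moreover have "1 / (of_int k)\<^sup>2 = (of_int k :: real) powr (- 2)"
      using x by (simp add: powr_minus_divide powr_numeral)
    ultimately have "Rat.Fract h k \<in> ?S" using x by (simp add: q)
    then show "x \<in> quotient_of ` ?S" using x q[of k h] by (intro image_eqI[of _ _ "Rat.Fract h k"]) auto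
  qed
  then have "finite (approx_set \<xi>)" using fin finite_subset by blast
  then show False using assms rational_iff_finite_approx_set by blast
qed

lemma irrationality_exponent_eq_2:
  fixes \<xi> :: real
  assumes "\<xi> \<notin> \<rat>" and "\<And>\<mu>. \<mu> > 2 \<Longrightarrow>
    \<exists>V. \<forall>(u::int) (q::int). q > 0 \<longrightarrow> \<bar>\<xi> - of_int u / of_int q\<bar> < of_int q powr (- \<mu>) \<longrightarrow> of_int q < (V::real)"
  shows "irrationality_exponent \<xi> = 2"
  unfolding irrationality_exponent_def
proof (rule Sup_eqI)
  fix y assume "y \<in> ereal ` {\<mu>. infinite {r. \<bar>\<xi> - of_rat r\<bar> < of_int (snd (quotient_of r)) powr (- \<mu>)}}"
  then obtain \<mu> where y: "y = ereal \<mu>"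
    and inf: "infinite {r. \<bar>\<xi> - of_rat r\<bar> < of_int (snd (quotient_of r)) powr (- \<mu>)}" by auto
  have "\<mu> \<le> 2"
  proof (rule ccontr)
    assume "\<not> \<mu> \<le> 2"
    then have \<mu>: "\<mu> > 2" by simp
    obtain V where V: "\<And>u q :: int. q > 0 \<Longrightarrow> \<bar>\<xi> - of_int u / of_int q\<bar> < of_int q powr (- \<mu>) \<Longrightarrow> of_int q < (V::real)"
      using assms(2)[OF \<mu>] by blast
    have "finite {r. \<bar>\<xi> - of_rat r\<bar> < of_int (snd (quotient_of r)) powr (- \<mu>)}"
    proof (rule finite_rats_bounded_denominator)
      fix r assume "r \<in> {r. \<bar>\<xi> - of_rat r\<bar> < of_int (snd (quotient_of r)) powr (- \<mu>)}"
      moreover obtain p q where pq: "quotient_of r = (p, q)" by fastforce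
      moreover have q: "q > 0" using quotient_of_denom_pos[OF pq] .
      moreover have "of_rat r = (of_int p / of_int q :: real)"
        using quotient_of_div[OF pq] q by (simp add: of_rat_divide)
      ultimately have *: "\<bar>\<xi> - of_int p / of_int q\<bar> < of_int q powr (- \<mu>)"
        "of_rat r = (of_int p / of_int q :: real)" "quotient_of r = (p, q)" "q > 0" by auto
      show "of_int (snd (quotient_of r)) < V" using V * by simp
      \<comment> \<open>Denominators are at least 1, so all these rationals lie within distance 1 of
        \<open>\<xi>\<close>; with bounded denominators this bounds the numerators too.\<close>
      have "of_int q powr (- \<mu>) \<le> (of_int q :: real) powr 0"
        using * \<mu> by (intro powr_mono) auto
      also have "\<dots> = 1" using * by simp
      finally show "\<bar>\<xi> - of_rat r\<bar> \<le> 1" using * by simp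
    qed
    then show False using inf by simp
  qed
  then show "y \<le> 2" unfolding y by simp
next
  fix y assume *: "\<And>z. z \<in> ereal ` {\<mu>. infinite {r. \<bar>\<xi> - of_rat r\<bar> < of_int (snd (quotient_of r)) powr (- \<mu>)}} \<Longrightarrow> z \<le> y"
  have "ereal 2 \<le> y"
    by (rule *) (use infinite_quadratic_approximations[OF assms(1)] in blast)
  then show "2 \<le> y" by simp
qed

theorem theorem2p5:
  fixes C D :: "int poly" and b :: int
  assumes "poly C 0 = 1" and "poly D 0 = 1"
    and "b \<ge> 2"
    and "\<forall>m::nat. poly (map_poly real_of_int C) (1 / real_of_int b ^ (3 ^ m))
                 * poly (map_poly real_of_int D) (1 / real_of_int b ^ (3 ^ m)) \<noteq> 0"
    and "\<not> rational_fps (reduce_mod3 (mahler_fps C D))"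
  shows "\<not> algebraic (mahler_value C D b)
         \<and> irrationality_exponent (mahler_value C D b) = 2"
proof -
  interpret mahler_point C D b
    using assms(1-4) by unfold_locales (auto simp: ev_def)
  have transcendental: "\<not> algebraic \<xi>"
    using assms(5) by (rule not_algebraic_xi)
  moreover have "\<xi> \<notin> \<rat>"
  proof
    assume "\<xi> \<in> \<rat>"
    then have "algebraic \<xi>"
      by (intro algebraicI'[of "[:- \<xi>, 1:]"]) (auto simp: coeff_pCons split: nat.splits)
    then show False using transcendental by blast
  qed
  then have "irrationality_exponent \<xi> = 2"
    using bounded_denominators[OF assms(5)] by (intro irrationality_exponent_eq_2)
  ultimately show ?thesis by blast
qed

end
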